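(* Let $\Phi$ be a random formula with $n$ variables and $m\in\Theta(n)$ clauses drawn from the weighted geometric model on $\mathbb T^d$ equipped with a $\mathfrak p$-norm, with temperature $0<T<1$, with $W\in O(n)$, and with $w_v\in O(n^{1-\varepsilon})$ for every variable $v$ and some constant $\varepsilon>0$. Then with probability $1-O(1/n)$, $\Theta(m)$ clauses of $\Phi$ are nice.
   Context: $\mathbb T^d$ is $[0,1]^d$ with opposite faces identified ($d$ a fixed constant), with distance $\mathrm{dist}(p,q)=\left(\sum_{i=1}^d|p_i-q_i|_\circ^{\mathfrak p}\right)^{1/\mathfrak p}$ (and $\max_i|p_i-q_i|_\circ$ for $\mathfrak p=\infty$), where $|a-b|_\circ=\min\{|a-b|,1-|a-b|\}$ and $\mathfrak p\in\mathbb N^+\cup\{\infty\}$ is fixed. Weighted geometric $k$-SAT model ($k$ constant): $n$ variables with weights $w_v\ge1$, minimum $1$, total $W=\sum_v w_v$, and $m$ clauses; all get independent uniformly random positions in $\mathbb T^d$. Connection weight $X(c,v)=\left(w_v/\mathrm{dist}(c,v)^d\right)^{1/T}$. Each clause draws $k$ variables one after another without repetition, each draw among the remaining variables with probability proportional to $X(c,v)$; signs are chosen among the $2^k$ patterns (details irrelevant here). A clause $c$ is nice if, for each $j\in[k]$, the $j$-th variable drawn for $c$ is the variable with the $j$-th highest connection weight with $c$. *)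

theory Defs
  imports "HOL-Probability.Probability" "HOL-Library.Landau_Symbols"
begin

text \<open>Points of the torus T^d are represented as functions nat => real whose
  components 0..d-1 lie in [0,1).\<close>

definition circ_dist :: "real \<Rightarrow> real \<Rightarrow> real" where
  "circ_dist a b = min \<bar>a - b\<bar> (1 - \<bar>a - b\<bar>)"

definition torus_dist :: "enat \<Rightarrow> nat \<Rightarrow> (nat \<Rightarrow> real) \<Rightarrow> (nat \<Rightarrow> real) \<Rightarrow> real" where
  "torus_dist p d x y =
     (case p of
        enat q \<Rightarrow> (\<Sum>i<d. circ_dist (x i) (y i) ^ q) powr (1 / real q)
      | \<infinity> \<Rightarrow> Max ((\<lambda>i. circ_dist (x i) (y i)) ` {..<d}))"

definition torus_space :: "nat \<Rightarrow> (nat \<Rightarrow> real) measure" where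
  "torus_space d = PiM {..<d} (\<lambda>_. uniform_measure lborel {0..<1::real})"

definition positions_space ::
  "nat \<Rightarrow> nat \<Rightarrow> nat \<Rightarrow> ((nat \<Rightarrow> nat \<Rightarrow> real) \<times> (nat \<Rightarrow> nat \<Rightarrow> real)) measure" where
  "positions_space d n m =
     PiM {..<n} (\<lambda>_. torus_space d) \<Otimes>\<^sub>M PiM {..<m} (\<lambda>_. torus_space d)"

definition conn_weight ::
  "real \<Rightarrow> nat \<Rightarrow> enat \<Rightarrow> real \<Rightarrow> (nat \<Rightarrow> real) \<Rightarrow> (nat \<Rightarrow> real) \<Rightarrow> real" where
  "conn_weight T d p wv xc xv = (wv / torus_dist p d xc xv ^ d) powr (1 / T)"

definition weighted_pmf :: "nat set \<Rightarrow> (nat \<Rightarrow> real) \<Rightarrow> nat pmf" where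
  "weighted_pmf S f = embed_pmf (\<lambda>v. if v \<in> S then f v / (\<Sum>u\<in>S. f u) else 0)"

fun draw_seq :: "(nat \<Rightarrow> real) \<Rightarrow> nat set \<Rightarrow> nat \<Rightarrow> nat list pmf" where
  "draw_seq f S 0 = return_pmf []"
| "draw_seq f S (Suc j) =
     do { v \<leftarrow> weighted_pmf S f;
          vs \<leftarrow> draw_seq f (S - {v}) j;
          return_pmf (v # vs) }"

definition clause_draws ::
  "real \<Rightarrow> nat \<Rightarrow> enat \<Rightarrow> nat \<Rightarrow> (nat \<Rightarrow> real) \<Rightarrow> nat \<Rightarrow> nat \<Rightarrow>
   (nat \<Rightarrow> nat \<Rightarrow> real) \<Rightarrow> (nat \<Rightarrow> nat \<Rightarrow> real) \<Rightarrow> (nat \<Rightarrow> nat list) pmf" where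
  "clause_draws T d p k w n m xs cs =
     Pi_pmf {..<m} [] (\<lambda>c. draw_seq (\<lambda>v. conn_weight T d p (w v) (cs c) (xs v)) {..<n} k)"

text \<open>A clause with connection weights X (on variables 0..n-1) and drawn list vs is
  nice if for each j the j-th drawn variable has the j-th highest connection
  weight, i.e. it has strictly larger weight than every variable not among the
  first j+1 drawn ones.\<close>
definition nice_clause :: "nat \<Rightarrow> (nat \<Rightarrow> real) \<Rightarrow> nat list \<Rightarrow> bool" where
  "nice_clause n X vs =
     (\<forall>j < length vs. \<forall>u < n. u \<notin> set (take (Suc j) vs) \<longrightarrow> X u < X (vs ! j))"

definition num_nice ::
  "real \<Rightarrow> nat \<Rightarrow> enat \<Rightarrow> (nat \<Rightarrow> real) \<Rightarrow> nat \<Rightarrow> nat \<Rightarrow>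
   (nat \<Rightarrow> nat \<Rightarrow> real) \<Rightarrow> (nat \<Rightarrow> nat \<Rightarrow> real) \<Rightarrow> (nat \<Rightarrow> nat list) \<Rightarrow> nat" where
  "num_nice T d p w n m xs cs D =
     card {c \<in> {..<m}. nice_clause n (\<lambda>v. conn_weight T d p (w v) (cs c) (xs v)) (D c)}"

definition prob_num_nice ::
  "real \<Rightarrow> nat \<Rightarrow> enat \<Rightarrow> nat \<Rightarrow> (nat \<Rightarrow> real) \<Rightarrow> nat \<Rightarrow> nat \<Rightarrow> (nat \<Rightarrow> bool) \<Rightarrow> ennreal" where
  "prob_num_nice T d p k w n m P =
     (\<integral>\<^sup>+ xc. emeasure (measure_pmf (clause_draws T d p k w n m (fst xc) (snd xc)))
                 {D. P (num_nice T d p w n m (fst xc) (snd xc) D)}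
        \<partial>positions_space d n m)"

end

theory Submission
  imports Defs "HOL-Real_Asymp.Real_Asymp"
begin

text \<open>
  Measure the distance between a clause and a variable \<open>v\<close> in units of \<open>w\<^sub>v\<close> to the power \<open>1/d\<close>, and put
  \<open>k + 1\<close> geometrically growing radii at the scale where the expected number of variables within
  reach of a clause is a small constant. If each of the \<open>k\<close> shells between them contains exactly one variable and
  nothing else is within the largest radius, then the \<open>k\<close> highest connection weights are strictly
  ordered; if moreover the remaining weights sum to at most a constant multiple of the \<open>k\<close>-th highest
  one, the clause is nice with constant probability.

  The shell condition holds at a fixed point with constant probability. Hence the volume of the
  set of clause positions satisfying it has constant expectation, and moving one variable \<open>v\<close> changes
  this volume by \<open>O(w\<^sub>v/n)\<close>. Since the squares of these influences sum to a negative power of \<open>n\<close>,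
  McDiarmid's inequality keeps the volume bounded below. The sum condition needs no randomness of
  the variables: because \<open>T < 1\<close>, for every placement of the variables the integral of the far
  weights over the clause position is bounded, and Markov's inequality applies. Conditionally on
  the variable positions the clauses are independent, and two Chernoff-type bounds finish the proof.
\<close>

section \<open>Concentration inequalities\<close>

text \<open>Exponential moment form of McDiarmid's inequality, by induction on the coordinates.
  Integrating out coordinate \<open>i\<close> gives \<open>g\<close>, which inherits the bound and
  the difference constants of the remaining coordinates; Hoeffding's lemma in coordinate
  \<open>i\<close> contributes the factor with \<open>c i\<close>.\<close>

lemma bounded_differences_mgf:
  fixes f :: "('i \<Rightarrow> 'a) \<Rightarrow> real" and c :: "'i \<Rightarrow> real"
  assumes "finite I" and prob: "\<And>i. prob_space (M i)" and l: "l > 0"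
    and f: "f \<in> borel_measurable (PiM I M)"
    and bound: "\<And>x. x \<in> space (PiM I M) \<Longrightarrow> \<bar>f x\<bar> \<le> B"
    and diff: "\<And>x i y. x \<in> space (PiM I M) \<Longrightarrow> i \<in> I \<Longrightarrow> y \<in> space (M i)
                 \<Longrightarrow> \<bar>f (x(i := y)) - f x\<bar> \<le> c i"
  shows "(\<integral>\<^sup>+x. ennreal (exp (l * (f x - integral\<^sup>L (PiM I M) f))) \<partial>PiM I M)
           \<le> ennreal (exp (l\<^sup>2 * (\<Sum>i\<in>I. (c i)\<^sup>2) / 2))"
  using assms(1) f bound diff
proof (induction I arbitrary: f rule: finite_induct)
  case empty
  interpret product_prob_space M UNIV
    by (intro product_prob_spaceI prob)
  show ?case by (simp add: PiM_empty nn_integral_count_space_finite lebesgue_integral_count_space_finite)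
next
  case (insert i I)
  interpret Mi: prob_space "M i" by (rule prob)
  interpret PiI: prob_space "PiM (insert i I) M" by (rule prob_space_PiM) (rule prob)
  interpret product_prob_space M UNIV
    by (intro product_prob_spaceI prob)
  note [measurable] = insert.prems(1)
  have sp: "x(i := y) \<in> space (PiM (insert i I) M)"
    if "x \<in> space (PiM I M)" "y \<in> space (M i)" for x y
    using that by (auto simp: space_PiM PiE_iff extensional_def)
  have bd: "\<bar>f (x(i := y))\<bar> \<le> B" if "x \<in> space (PiM I M)" "y \<in> space (M i)" for x y
    by (rule insert.prems(2)[OF sp[OF that]])
  have meas1: "(\<lambda>y. f (x(i := y))) \<in> borel_measurable (M i)" if x: "x \<in> space (PiM I M)" for x
    using measurable_comp[OF measurable_component_update[OF x \<open>i \<notin> I\<close>] insert.prems(1)]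
    by (simp add: comp_def)
  have int1: "integrable (M i) (\<lambda>y. f (x(i := y)))" if "x \<in> space (PiM I M)" for x
    by (rule Mi.integrable_const_bound[where B = B]) (use bd[OF that] meas1[OF that] in auto)
  define g where "g = (\<lambda>x. \<integral>y. f (x(i := y)) \<partial>M i)"
  have meas2: "(\<lambda>(x, y). f (x(i := y))) \<in> borel_measurable (PiM I M \<Otimes>\<^sub>M M i)"
    by measurable
  have g_meas [measurable]: "g \<in> borel_measurable (PiM I M)"
    unfolding g_def by measurable
  have intf: "integrable (PiM (insert i I) M) f"
    by (rule PiI.integrable_const_bound[where B = B]) (use insert.prems in auto)
  have Ef: "integral\<^sup>L (PiM (insert i I) M) f = integral\<^sup>L (PiM I M) g"
    unfolding g_def by (rule product_integral_insert[OF insert.hyps(1,2) intf])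
  have gb: "\<bar>g x\<bar> \<le> B" if x: "x \<in> space (PiM I M)" for x
  proof -
    have "\<bar>g x\<bar> \<le> (\<integral>y. \<bar>f (x(i := y))\<bar> \<partial>M i)"
      unfolding g_def by (rule integral_abs_bound)
    also have "\<dots> \<le> (\<integral>y. B \<partial>M i)"
      by (rule integral_mono) (use int1[OF x] bd[OF x] in auto)
    finally show ?thesis by (simp add: Mi.prob_space)
  qed
  have gd: "\<bar>g (x(j := z)) - g x\<bar> \<le> c j"
    if x: "x \<in> space (PiM I M)" and j: "j \<in> I" and z: "z \<in> space (M j)" for x j z
  proof -
    have x': "x(j := z) \<in> space (PiM I M)"
      using x j z by (auto simp: space_PiM PiE_iff extensional_def)
    have ij: "i \<noteq> j" using j insert.hyps by auto
    have "\<bar>g (x(j := z)) - g x\<bar> = \<bar>\<integral>y. f ((x(j := z))(i := y)) - f (x(i := y)) \<partial>M i\<bar>"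
      unfolding g_def by (subst Bochner_Integration.integral_diff[OF int1[OF x'] int1[OF x]]) simp
    also have "\<dots> \<le> (\<integral>y. \<bar>f ((x(j := z))(i := y)) - f (x(i := y))\<bar> \<partial>M i)"
      by (rule integral_abs_bound)
    also have "\<dots> \<le> (\<integral>y. c j \<partial>M i)"
    proof (rule integral_mono)
      fix y assume y: "y \<in> space (M i)"
      show "\<bar>f ((x(j := z))(i := y)) - f (x(i := y))\<bar> \<le> c j"
        unfolding fun_upd_twist[OF ij[symmetric]]
        by (rule insert.prems(3)[OF sp[OF x y] _ z]) (use j in simp)
    qed (use int1[OF x] int1[OF x'] in auto)
    finally show ?thesis by (simp add: Mi.prob_space)
  qed
  have inner: "(\<integral>\<^sup>+y. ennreal (exp (l * (f (x(i := y)) - g x))) \<partial>M i) \<le> ennreal (exp (l\<^sup>2 * (c i)\<^sup>2 / 2))"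
    if x: "x \<in> space (PiM I M)" for x
  proof -
    obtain y0 where y0: "y0 \<in> space (M i)" using Mi.not_empty by auto
    \<comment> \<open>The interval is centred at the value for an arbitrary reference point
      \<open>y0\<close>. Its width \<open>2 * c i\<close> turns the constant \<open>1/8\<close> of
      Hoeffding's lemma into \<open>1/2\<close>.\<close>
    interpret interval_bounded_random_variable "M i" "\<lambda>y. f (x(i := y))"
        "f (x(i := y0)) - c i" "f (x(i := y0)) + c i"
    proof unfold_locales
      show "AE y in M i. f (x(i := y)) \<in> {f (x(i := y0)) - c i..f (x(i := y0)) + c i}"
      proof (rule AE_I2)
        fix y assume y: "y \<in> space (M i)"
        show "f (x(i := y)) \<in> {f (x(i := y0)) - c i..f (x(i := y0)) + c i}"
        proof -
          have "\<bar>f ((x(i := y0))(i := y)) - f (x(i := y0))\<bar> \<le> c i"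
            by (rule insert.prems(3)[OF sp[OF x y0] _ y]) simp
          then show ?thesis unfolding fun_upd_upd by (simp add: abs_le_iff)
        qed
      qed
    qed (rule meas1[OF x])
    have e: "f (x(i := y0)) + c i - (f (x(i := y0)) - c i) = 2 * c i" by simp
    show ?thesis
      using Hoeffdings_lemma_nn_integral[OF l] unfolding e
      by (simp add: g_def power_mult_distrib mult.commute)
  qed
  have "(\<integral>\<^sup>+x. ennreal (exp (l * (f x - integral\<^sup>L (PiM (insert i I) M) f))) \<partial>PiM (insert i I) M)
      = (\<integral>\<^sup>+x. (\<integral>\<^sup>+y. ennreal (exp (l * (f (x(i := y)) - integral\<^sup>L (PiM I M) g))) \<partial>M i) \<partial>PiM I M)"
    unfolding Ef by (rule product_nn_integral_insert[OF insert.hyps(1,2)]) measurable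
  also have "\<dots> \<le> (\<integral>\<^sup>+x. ennreal (exp (l\<^sup>2 * (c i)\<^sup>2 / 2)) *
                    ennreal (exp (l * (g x - integral\<^sup>L (PiM I M) g))) \<partial>PiM I M)"
  proof (rule nn_integral_mono)
    fix x assume x: "x \<in> space (PiM I M)"
    note [measurable] = meas1[OF x]
    \<comment> \<open>The exponent is split at the conditional mean \<open>g x\<close>; the second
      factor is constant in \<open>y\<close> and leaves the inner integral.\<close>
    have "(\<integral>\<^sup>+y. ennreal (exp (l * (f (x(i := y)) - integral\<^sup>L (PiM I M) g))) \<partial>M i)
        = (\<integral>\<^sup>+y. ennreal (exp (l * (f (x(i := y)) - g x))) *
                 ennreal (exp (l * (g x - integral\<^sup>L (PiM I M) g))) \<partial>M i)"
      by (simp add: algebra_simps flip: ennreal_mult exp_add)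
    also have "\<dots> = (\<integral>\<^sup>+y. ennreal (exp (l * (f (x(i := y)) - g x))) \<partial>M i) *
                 ennreal (exp (l * (g x - integral\<^sup>L (PiM I M) g)))"
      by (rule nn_integral_multc) measurable
    also have "\<dots> \<le> ennreal (exp (l\<^sup>2 * (c i)\<^sup>2 / 2)) * ennreal (exp (l * (g x - integral\<^sup>L (PiM I M) g)))"
      by (intro mult_right_mono inner x) simp
    finally show "(\<integral>\<^sup>+y. ennreal (exp (l * (f (x(i := y)) - integral\<^sup>L (PiM I M) g))) \<partial>M i) \<le> \<dots>" .
  qed
  also have "\<dots> = ennreal (exp (l\<^sup>2 * (c i)\<^sup>2 / 2)) *
       (\<integral>\<^sup>+x. ennreal (exp (l * (g x - integral\<^sup>L (PiM I M) g))) \<partial>PiM I M)"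
    by (rule nn_integral_cmult) measurable
  also have "\<dots> \<le> ennreal (exp (l\<^sup>2 * (c i)\<^sup>2 / 2)) * ennreal (exp (l\<^sup>2 * (\<Sum>i\<in>I. (c i)\<^sup>2) / 2))"
    by (intro mult_left_mono insert.IH g_meas gb gd) auto
  also have "\<dots> = ennreal (exp (l\<^sup>2 * (\<Sum>i\<in>insert i I. (c i)\<^sup>2) / 2))"
    using insert.hyps by (simp add: algebra_simps add_divide_distrib flip: ennreal_mult exp_add)
  finally show ?case .
qed

text \<open>Chernoff's bound for the deviation of \<open>- f\<close> above its mean, combined with
  the moment bound above. An upper bound \<open>S\<close> for the sum of squares suffices, so the
  sum itself need not be computed.\<close>

lemma bounded_differences_lower_tail:
  fixes f :: "('i \<Rightarrow> 'a) \<Rightarrow> real" and c :: "'i \<Rightarrow> real"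
  assumes fin: "finite I" and prob: "\<And>i. prob_space (M i)" and t: "t > 0"
    and f [measurable]: "f \<in> borel_measurable (PiM I M)"
    and bound: "\<And>x. x \<in> space (PiM I M) \<Longrightarrow> \<bar>f x\<bar> \<le> B"
    and diff: "\<And>x i y. x \<in> space (PiM I M) \<Longrightarrow> i \<in> I \<Longrightarrow> y \<in> space (M i)
                 \<Longrightarrow> \<bar>f (x(i := y)) - f x\<bar> \<le> c i"
    and S: "(\<Sum>i\<in>I. (c i)\<^sup>2) \<le> S" "S > 0"
  shows "measure (PiM I M) {x \<in> space (PiM I M). f x \<le> integral\<^sup>L (PiM I M) f - t}
           \<le> exp (- t\<^sup>2 / (2 * S))"
proof -
  interpret PI: prob_space "PiM I M" by (rule prob_space_PiM) (rule prob)
  \<comment> \<open>The minimiser of the exponent \<open>l\<^sup>2 * S / 2 - l * t\<close>.\<close>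
  define l where "l = t / S"
  have l: "l > 0" using t S by (simp add: l_def)
  let ?E = "integral\<^sup>L (PiM I M) f"
  have "emeasure (PiM I M) {x \<in> space (PiM I M). f x \<le> ?E - t}
      = emeasure (PiM I M) {x \<in> space (PiM I M). ?E - f x \<ge> t}"
    by (rule arg_cong[where f = "emeasure _"]) auto
  also have "\<dots> \<le> ennreal (exp (- l * t)) * (\<integral>\<^sup>+x\<in>space (PiM I M). ennreal (exp (l * (?E - f x))) \<partial>PiM I M)"
    by (intro Chernoff_ineq_nn_integral_ge l) auto
  also have "(\<integral>\<^sup>+x\<in>space (PiM I M). ennreal (exp (l * (?E - f x))) \<partial>PiM I M) =
      (\<integral>\<^sup>+x. ennreal (exp (l * (- f x - integral\<^sup>L (PiM I M) (\<lambda>x. - f x)))) \<partial>PiM I M)"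
    by (intro nn_integral_cong) auto
  also have "\<dots> \<le> ennreal (exp (l\<^sup>2 * (\<Sum>i\<in>I. (c i)\<^sup>2) / 2))"
    by (rule bounded_differences_mgf[OF fin prob l, where B = B])
       (use bound diff in \<open>auto simp: abs_minus_commute\<close>)
  also have "\<dots> \<le> ennreal (exp (l\<^sup>2 * S / 2))"
    using S by (intro ennreal_leI) (simp add: mult_left_mono)
  also have "ennreal (exp (- l * t)) * \<dots> = ennreal (exp (- t\<^sup>2 / (2 * S)))"
    using S by (simp add: l_def field_simps power2_eq_square flip: ennreal_mult exp_add)
  finally show ?thesis
    by (simp add: PI.emeasure_eq_measure mult_left_mono)
qed

text \<open>Hoeffding's inequality for the independent indicators of the indices in \<open>G\<close>
  only; successes outside \<open>G\<close> can only increase the count. The deviation is half of the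
  guaranteed mean. It is applied with \<open>G\<close> the clauses in good position and
  \<open>N c\<close> their nice draws.\<close>

lemma Pi_pmf_count_lower_tail:
  fixes \<mu> :: "'i \<Rightarrow> 'a pmf"
  assumes A: "finite A" and G: "G \<subseteq> A" and q: "0 < q"
    and P: "\<And>c. c \<in> G \<Longrightarrow> measure_pmf.prob (\<mu> c) (N c) \<ge> q"
  shows "measure_pmf.prob (Pi_pmf A dflt \<mu>) {D. real (card {c \<in> A. D c \<in> N c}) \<ge> real (card G) * q / 2}
           \<ge> 1 - exp (- real (card G) * q\<^sup>2 / 2)"
proof (cases "G = {}")
  \<comment> \<open>The claimed bound is \<open>0\<close> here; Hoeffding's exponent would divide by
    \<open>card G = 0\<close>.\<close>
  case True
  then show ?thesis by simp
next
  case False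
  have finG: "finite G" using A G finite_subset by blast
  have cG: "card G > 0" using False finG by (simp add: card_gt_0_iff)
  let ?M = "Pi_pmf A dflt \<mu>"
  define X where "X = (\<lambda>c (D :: 'i \<Rightarrow> 'a). indicator (N c) (D c) :: real)"
  interpret Hoeffding_ineq "measure_pmf ?M" G X "\<lambda>_. 0" "\<lambda>_. 1" "\<Sum>c\<in>G. measure_pmf.expectation ?M (X c)"
  proof unfold_locales
    have "prob_space.indep_vars ?M (\<lambda>_. count_space UNIV) (\<lambda>x f. f x) G"
      by (rule prob_space.indep_vars_subset[OF measure_pmf.prob_space_axioms indep_vars_Pi_pmf[OF A] G])
    then show "prob_space.indep_vars ?M (\<lambda>_. borel) X G"
      unfolding X_def by (rule prob_space.indep_vars_compose2[OF measure_pmf.prob_space_axioms]) auto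
  qed (auto simp: finG X_def indicator_def)
  have E: "measure_pmf.expectation ?M (X c) \<ge> q" if "c \<in> G" for c
  proof -
    have "measure_pmf.expectation ?M (X c) = measure_pmf.expectation (map_pmf (\<lambda>D. D c) ?M) (indicator (N c))"
      by (subst integral_map_pmf) (simp add: X_def)
    also have "map_pmf (\<lambda>D. D c) ?M = \<mu> c"
      using Pi_pmf_component[OF A, of c dflt \<mu>] that G by auto
    finally show ?thesis using P[OF that] by simp
  qed
  have mu: "(\<Sum>c\<in>G. measure_pmf.expectation ?M (X c)) \<ge> real (card G) * q"
    using sum_mono[of G "\<lambda>_. q", OF E] by simp
  have "measure_pmf.prob ?M {D. real (card {c \<in> A. D c \<in> N c}) < real (card G) * q / 2}
      \<le> measure_pmf.prob ?M {D \<in> space ?M. (\<Sum>c\<in>G. X c D) \<le> (\<Sum>c\<in>G. measure_pmf.expectation ?M (X c)) - real (card G) * q / 2}"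
  proof (rule measure_pmf.finite_measure_mono)
    show "{D. real (card {c \<in> A. D c \<in> N c}) < real (card G) * q / 2} \<subseteq>
      {D \<in> space ?M. (\<Sum>c\<in>G. X c D) \<le> (\<Sum>c\<in>G. measure_pmf.expectation ?M (X c)) - real (card G) * q / 2}"
    proof
      fix D assume D: "D \<in> {D. real (card {c \<in> A. D c \<in> N c}) < real (card G) * q / 2}"
      have "(\<Sum>c\<in>G. X c D) = real (card {c \<in> G. D c \<in> N c})"
        using finG by (simp add: X_def indicator_def sum.If_cases Int_def)
      also have "\<dots> \<le> real (card {c \<in> A. D c \<in> N c})"
        using G A by (intro of_nat_mono card_mono) auto
      finally show "D \<in> {D \<in> space ?M. (\<Sum>c\<in>G. X c D) \<le> (\<Sum>c\<in>G. measure_pmf.expectation ?M (X c)) - real (card G) * q / 2}"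
        using D mu by auto
    qed
  qed auto
  also have "\<dots> \<le> exp (-2 * (real (card G) * q / 2)\<^sup>2 / (\<Sum>c\<in>G. (1 - 0)\<^sup>2))"
    by (rule Hoeffding_ineq_le) (use q cG in auto)
  also have "\<dots> = exp (- real (card G) * q\<^sup>2 / 2)"
    using cG by (simp add: power2_eq_square field_simps)
  finally have le: "measure_pmf.prob ?M {D. real (card {c \<in> A. D c \<in> N c}) < real (card G) * q / 2}
      \<le> exp (- real (card G) * q\<^sup>2 / 2)" .
  have "measure_pmf.prob ?M {D. real (card {c \<in> A. D c \<in> N c}) \<ge> real (card G) * q / 2}
     = 1 - measure_pmf.prob ?M {D. real (card {c \<in> A. D c \<in> N c}) < real (card G) * q / 2}"
    by (subst measure_pmf.prob_compl[symmetric]) (auto intro!: arg_cong[where f = "measure _"])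
  then show ?thesis using le by linarith
qed

text \<open>The count changes by at most 1 when one coordinate moves, so the bounded difference
  inequality applies with \<open>S = m\<close> and deviation \<open>q * m / 2\<close>.\<close>

lemma count_lower_tail:
  fixes M :: "'a measure"
  assumes M: "prob_space M" and S: "S \<in> sets M" and q: "q \<le> measure M S" "q > 0" and m: "m > 0"
  shows "measure (PiM {..<m} (\<lambda>_. M)) {y \<in> space (PiM {..<m} (\<lambda>_. M)).
            real (card {c \<in> {..<m}. y c \<in> S}) \<ge> q * real m / 2} \<ge> 1 - exp (- real m * q\<^sup>2 / 8)"
proof -
  let ?P = "PiM {..<m::nat} (\<lambda>_. M)"
  interpret M: prob_space M by (rule M)
  interpret P: prob_space ?P by (rule prob_space_PiM) (rule M)
  interpret product_prob_space "\<lambda>_::nat. M" "{..<m}"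
    by (intro product_prob_spaceI M)
  define f where "f = (\<lambda>y::nat \<Rightarrow> 'a. \<Sum>c<m. indicator S (y c) :: real)"
  have f_eq: "f y = real (card {c \<in> {..<m}. y c \<in> S})" for y
    by (simp add: f_def indicator_def sum.If_cases Int_def)
  have comp: "(\<lambda>y. indicator S (y c) :: real) \<in> borel_measurable ?P" if "c < m" for c
    by (rule measurable_compose[OF _ borel_measurable_indicator[OF S]])
       (rule measurable_component_singleton, use that in simp)
  have fm [measurable]: "f \<in> borel_measurable ?P"
    unfolding f_def by (rule borel_measurable_sum) (use comp in auto)
  have "integral\<^sup>L ?P f = (\<Sum>c<m. integral\<^sup>L ?P (\<lambda>y. indicator S (y c)))"
    unfolding f_def
    by (rule Bochner_Integration.integral_sum)
       (auto intro!: P.integrable_const_bound[where B = 1] comp)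
  also have "\<dots> = (\<Sum>c<m. measure M S)"
  proof (rule sum.cong)
    fix c assume c: "c \<in> {..<m}"
    have "integral\<^sup>L ?P (\<lambda>y. indicator S (y c) :: real) = integral\<^sup>L (distr ?P M (\<lambda>y. y c)) (indicator S)"
      by (rule integral_distr[symmetric]) (use c S in auto)
    also have "distr ?P M (\<lambda>y. y c) = M" by (rule PiM_component[OF c])
    finally show "integral\<^sup>L ?P (\<lambda>y. indicator S (y c)) = measure M S"
      using S by simp
  qed simp
  finally have Ef: "integral\<^sup>L ?P f = real m * measure M S" by simp
  have Ef': "integral\<^sup>L ?P f \<ge> q * real m" unfolding Ef using q m by (simp add: mult.commute)
  have "measure ?P {y \<in> space ?P. f y < q * real m / 2}
      \<le> measure ?P {y \<in> space ?P. f y \<le> integral\<^sup>L ?P f - q * real m / 2}"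
    by (rule P.finite_measure_mono) (use Ef' in auto)
  also have "\<dots> \<le> exp (- (q * real m / 2)\<^sup>2 / (2 * real m))"
  proof (rule bounded_differences_lower_tail[where c = "\<lambda>_. 1" and B = "real m"])
    fix y assume "y \<in> space ?P"
    have "f y \<le> (\<Sum>c<m. 1)" unfolding f_def by (intro sum_mono) (auto simp: indicator_def)
    then show "\<bar>f y\<bar> \<le> real m" by (simp add: f_def sum_nonneg)
  next
    fix y c z assume c: "c \<in> {..<m}"
    have "f (y(c := z)) = indicator S z + (\<Sum>c\<in>{..<m} - {c}. indicator S (y c))"
      unfolding f_def using c by (subst sum.remove[of _ c]) (auto intro!: sum.cong)
    moreover have "f y = indicator S (y c) + (\<Sum>c\<in>{..<m} - {c}. indicator S (y c))"
      unfolding f_def using c by (subst sum.remove[of _ c]) auto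
    ultimately show "\<bar>f (y(c := z)) - f y\<bar> \<le> 1" by (auto simp: indicator_def)
  qed (use M q m in auto)
  also have "\<dots> = exp (- real m * q\<^sup>2 / 8)"
    using m by (simp add: power2_eq_square field_simps)
  finally have le: "measure ?P {y \<in> space ?P. f y < q * real m / 2} \<le> exp (- real m * q\<^sup>2 / 8)" .
  have "measure ?P {y \<in> space ?P. f y \<ge> q * real m / 2} = 1 - measure ?P {y \<in> space ?P. f y < q * real m / 2}"
    by (subst P.prob_compl[symmetric]) (auto intro!: arg_cong[where f = "measure _"])
  then show ?thesis using le by (simp add: f_eq)
qed

section \<open>Drawing without repetition\<close>

text \<open>\<open>embed_pmf\<close> has the intended values only for a nonnegative function of
  total mass 1. Positivity of \<open>f\<close> on the nonempty finite set \<open>S\<close> provides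
  both.\<close>

lemma pmf_weighted_pmf:
  assumes "finite S" "\<And>v. v \<in> S \<Longrightarrow> f v > 0" "v \<in> S"
  shows "pmf (weighted_pmf S f) v = f v / (\<Sum>u\<in>S. f u)"
proof -
  have pos: "(\<Sum>u\<in>S. f u) > 0" using assms by (intro sum_pos) auto
  have "(\<integral>\<^sup>+u. ennreal (if u \<in> S then f u / (\<Sum>u\<in>S. f u) else 0) \<partial>count_space UNIV)
      = (\<Sum>u\<in>S. ennreal (f u / (\<Sum>u\<in>S. f u)))"
    by (subst nn_integral_count_space'[OF assms(1)]) (auto intro!: sum.cong)
  also have "\<dots> = ennreal (\<Sum>u\<in>S. f u / (\<Sum>u\<in>S. f u))"
    using assms pos by (intro sum_ennreal) (auto intro!: divide_nonneg_pos less_imp_le)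
  also have "\<dots> = 1" using pos by (simp flip: sum_divide_distrib)
  finally have *: "(\<integral>\<^sup>+u. ennreal (if u \<in> S then f u / (\<Sum>u\<in>S. f u) else 0) \<partial>count_space UNIV) = 1" .
  show ?thesis
    unfolding weighted_pmf_def
    by (subst pmf_embed_pmf[OF _ *])
       (use assms pos in \<open>auto intro!: divide_nonneg_pos less_imp_le\<close>)
qed

text \<open>Chain rule: the probability of one particular sequence is the product of its stepwise
  drawing ratios, and each ratio is at least \<open>1 / L\<close> when the weight still available is
  at most \<open>L\<close> times the weight drawn.\<close>

lemma draw_seq_lower_bound:
  assumes "finite S" "\<And>v. v \<in> S \<Longrightarrow> f v > 0" "distinct vs" "set vs \<subseteq> S" "L > 0"
    and "\<And>j. j < length vs \<Longrightarrow> (\<Sum>u\<in>S - set (take j vs). f u) \<le> L * f (vs ! j)"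
  shows "pmf (draw_seq f S (length vs)) vs \<ge> (1 / L) ^ length vs"
  using assms
proof (induction vs arbitrary: S)
  case Nil
  then show ?case by simp
next
  case (Cons v vs)
  have v: "v \<in> S" "f v > 0" using Cons.prems by auto
  have s: "(\<Sum>u\<in>S. f u) \<le> L * f v" using Cons.prems(6)[of 0] by simp
  have spos: "(\<Sum>u\<in>S. f u) > 0" using Cons.prems(1,2) v by (intro sum_pos) auto
  have IH: "pmf (draw_seq f (S - {v}) (length vs)) vs \<ge> (1 / L) ^ length vs"
  proof (rule Cons.IH)
    fix j assume "j < length vs"
    then show "(\<Sum>u\<in>S - {v} - set (take j vs). f u) \<le> L * f (vs ! j)"
      using Cons.prems(6)[of "Suc j"] by (simp add: Diff_insert2[symmetric] del: Diff_insert0)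
  qed (use Cons.prems in auto)
  have "(1 / L) ^ length (v # vs) = 1 / L * (1 / L) ^ length vs" by simp
  also have "\<dots> \<le> f v / (\<Sum>u\<in>S. f u) * pmf (draw_seq f (S - {v}) (length vs)) vs"
    using s spos v Cons.prems(5) IH
    by (intro mult_mono) (auto simp: field_simps)
  also have "\<dots> = pmf (weighted_pmf S f) v * pmf (draw_seq f (S - {v}) (length vs)) vs"
    using Cons.prems v by (subst pmf_weighted_pmf) auto
  also have "\<dots> \<le> pmf (draw_seq f S (length (v # vs))) (v # vs)"
  proof -
    have "pmf (draw_seq f S (length (v # vs))) (v # vs) =
       (\<integral>u. pmf (bind_pmf (draw_seq f (S - {u}) (length vs)) (\<lambda>vs. return_pmf (u # vs))) (v # vs)
             \<partial>measure_pmf (weighted_pmf S f))"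
      by (simp add: pmf_bind)
    \<comment> \<open>The expectation over the first draw is restricted to the event that this draw
      is \<open>v\<close>.\<close>
    also have "\<dots> \<ge> (\<integral>u. indicator {v} u * pmf (draw_seq f (S - {v}) (length vs)) vs
             \<partial>measure_pmf (weighted_pmf S f))"
    proof (rule integral_mono)
      fix u
      have "pmf (map_pmf ((#) v) (draw_seq f (S - {v}) (length vs))) (v # vs)
          = pmf (draw_seq f (S - {v}) (length vs)) vs"
        by (rule pmf_map_inj') (auto simp: inj_def)
      then show "indicator {v} u * pmf (draw_seq f (S - {v}) (length vs)) vs
          \<le> pmf (bind_pmf (draw_seq f (S - {u}) (length vs)) (\<lambda>vs. return_pmf (u # vs))) (v # vs)"
        by (auto simp: indicator_def map_pmf_def)
    next
      show "integrable (weighted_pmf S f) (\<lambda>u. indicator {v} u * pmf (draw_seq f (S - {v}) (length vs)) vs)"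
        by (rule measure_pmf.integrable_const_bound[where B = 1])
           (auto simp: indicator_def pmf_le_1)
    next
      show "integrable (weighted_pmf S f) (\<lambda>u. pmf (bind_pmf (draw_seq f (S - {u}) (length vs)) (\<lambda>vs. return_pmf (u # vs))) (v # vs))"
        by (rule measure_pmf.integrable_const_bound[where B = 1])
           (auto simp: pmf_le_1)
    qed
    finally show ?thesis by (simp add: pmf.rep_eq)
  qed
  finally show ?case .
qed

section \<open>Balls in the torus\<close>

lemma measure_PiM_PiE:
  assumes "finite I" "\<And>i. prob_space (M i)" "\<And>i. i \<in> I \<Longrightarrow> A i \<in> sets (M i)"
  shows "measure (PiM I M) (PiE I A) = (\<Prod>i\<in>I. measure (M i) (A i))"
proof -
  interpret PI: prob_space "PiM I M" by (rule prob_space_PiM) (rule assms(2))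
  interpret product_prob_space M UNIV
    by (intro product_prob_spaceI assms(2))
  have "emeasure (PiM I M) (PiE I A) = (\<Prod>i\<in>I. emeasure (M i) (A i))"
    by (rule emeasure_PiM) (use assms in auto)
  also have "\<dots> = ennreal (\<Prod>i\<in>I. measure (M i) (A i))"
    by (subst prod_ennreal[symmetric])
       (auto simp: finite_measure.emeasure_eq_measure[OF prob_space.finite_measure[OF assms(2)]])
  finally show ?thesis
    by (simp add: PI.emeasure_eq_measure prod_nonneg)
qed

section \<open>Balls on the circle of length one\<close>

lemma measure_uniform_interval:
  assumes "B \<subseteq> {0..<1::real}"
  shows "measure (uniform_measure lborel {0..<1}) B = measure lborel B"
proof (cases "B \<in> sets lborel")
  case True
  then show ?thesis using assms
    by (subst measure_uniform_measure) (auto simp: Int_absorb1)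
next
  case False
  then show ?thesis by (simp add: measure_notin_sets)
qed

lemma prob_space_uniform_interval: "prob_space (uniform_measure lborel {0..<1::real})"
  by (rule prob_space_uniform_measure) auto

lemma circ_dist_measurable [measurable (raw)]:
  assumes [measurable]: "f \<in> borel_measurable M" "g \<in> borel_measurable M"
  shows "(\<lambda>x. circ_dist (f x) (g x)) \<in> borel_measurable M"
  unfolding circ_dist_def by measurable

lemma circ_dist_nonneg: "0 \<le> a \<Longrightarrow> a < 1 \<Longrightarrow> 0 \<le> b \<Longrightarrow> b < 1 \<Longrightarrow> 0 \<le> circ_dist a b"
  unfolding circ_dist_def by auto

lemma circ_dist_commute: "circ_dist a b = circ_dist b a"
  unfolding circ_dist_def by (simp add: abs_minus_commute)

lemma fmeasurable_Icc: "{a..b::real} \<in> fmeasurable lborel"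
  by (rule fmeasurableI) (auto simp: emeasure_lborel_Icc_eq)

lemma measure_lborel_Icc_max: "measure lborel {a..b::real} = max 0 (b - a)"
  by (cases "a \<le> b") auto

text \<open>For \<open>r < 1/2\<close> the ball is covered by the truncated interval around
  \<open>a\<close> and two pieces that wrap around at 0 and 1; what truncation removes at one end is
  what reappears at the other. For larger \<open>r\<close> the bound is at least 1.\<close>

lemma measure_circ_ball_le:
  assumes a: "0 \<le> a" "a < 1" and r: "r \<ge> 0"
  shows "measure (uniform_measure lborel {0..<1}) {b \<in> {0..<1}. circ_dist a b \<le> r} \<le> 2 * r"
proof (cases "r \<ge> 1 / 2")
  case True
  then show ?thesis
    using prob_space.prob_le_1[OF prob_space_uniform_interval, of "{b \<in> {0..<1}. circ_dist a b \<le> r}"]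
    by linarith
next
  case False
  have "measure (uniform_measure lborel {0..<1}) {b \<in> {0..<1}. circ_dist a b \<le> r}
      = measure lborel {b \<in> {0..<1}. circ_dist a b \<le> r}"
    by (rule measure_uniform_interval) auto
  also have "\<dots> \<le> measure lborel (({max 0 (a - r)..min 1 (a + r)} \<union> {0..a + r - 1}) \<union> {a - r + 1..1})"
  proof (rule measure_mono_fmeasurable)
    show "{b \<in> {0..<1}. circ_dist a b \<le> r} \<subseteq> ({max 0 (a - r)..min 1 (a + r)} \<union> {0..a + r - 1}) \<union> {a - r + 1..1}"
      using a by (auto simp: circ_dist_def min_le_iff_disj abs_le_iff abs_if split: if_splits)
  qed (auto intro!: fmeasurable.Un fmeasurable_Icc)
  also have "\<dots> \<le> measure lborel {max 0 (a - r)..min 1 (a + r)} + measure lborel {0..a + r - 1} + measure lborel {a - r + 1..1}"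
    by (intro order_trans[OF measure_Un_le] add_mono order_refl) auto
  also have "\<dots> \<le> 2 * r"
    using a r False by (simp add: measure_lborel_Icc_max max_def min_def)
  finally show ?thesis .
qed

text \<open>A one-sided interval of length \<open>r\<close> starting at \<open>a\<close> and
  pointing towards the farther end of the unit interval avoids all wrapping. This gives up a factor
  of 2.\<close>

lemma measure_circ_ball_ge:
  assumes a: "0 \<le> a" "a < 1" and r: "0 \<le> r" "r \<le> 1 / 2"
  shows "measure (uniform_measure lborel {0..<1}) {b \<in> {0..<1}. circ_dist a b \<le> r} \<ge> r"
proof -
  have *: "measure (uniform_measure lborel {0..<1}) {b \<in> {0..<1}. circ_dist a b \<le> r}
      = measure lborel {b \<in> {0..<1}. circ_dist a b \<le> r}"
    by (rule measure_uniform_interval) auto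
  have fm: "{b \<in> {0..<1}. circ_dist a b \<le> r} \<in> fmeasurable lborel"
    by (rule fmeasurableI2[OF fmeasurable_Icc[of 0 1]]) auto
  show ?thesis
  proof (cases "a < 1 / 2")
    case True
    have "r = measure lborel {a..<a + r}" using r by simp
    also have "\<dots> \<le> measure lborel {b \<in> {0..<1}. circ_dist a b \<le> r}"
      by (rule measure_mono_fmeasurable[OF _ _ fm])
         (use a r True in \<open>auto simp: circ_dist_def min_le_iff_disj\<close>)
    finally show ?thesis using * by simp
  next
    case False
    have "r = measure lborel {a - r..a}" using r by simp
    also have "\<dots> \<le> measure lborel {b \<in> {0..<1}. circ_dist a b \<le> r}"
      by (rule measure_mono_fmeasurable[OF _ _ fm])
         (use a r False in \<open>auto simp: circ_dist_def min_le_iff_disj\<close>)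
    finally show ?thesis using * by simp
  qed
qed

section \<open>The torus as a probability space, and measurability of distances\<close>

lemma prob_space_torus: "prob_space (torus_space d)"
  unfolding torus_space_def by (rule prob_space_PiM) (rule prob_space_uniform_interval)

lemma space_torus: "space (torus_space d) = extensional {..<d}"
  by (simp add: torus_space_def space_PiM PiE_UNIV_domain PiE_def)

lemma torus_component_measurable [measurable (raw)]:
  assumes "i < d" "f \<in> measurable M (torus_space d)"
  shows "(\<lambda>x. f x i) \<in> borel_measurable M"
proof -
  have "(\<lambda>y. y i) \<in> measurable (torus_space d) (uniform_measure lborel {0..<1::real})"
    unfolding torus_space_def by (rule measurable_component_singleton) (use assms(1) in simp)
  then have "(\<lambda>y. y i) \<in> borel_measurable (torus_space d)"
    by (simp cong: measurable_cong_sets)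
  from measurable_compose[OF assms(2) this] show ?thesis .
qed

lemma torus_dist_measurable [measurable (raw)]:
  assumes [measurable]: "f \<in> measurable M (torus_space d)" "g \<in> measurable M (torus_space d)"
  shows "(\<lambda>x. torus_dist p d (f x) (g x)) \<in> borel_measurable M"
proof (cases p)
  case (enat q)
  show ?thesis unfolding torus_dist_def enat by simp measurable
next
  case infinity
  show ?thesis unfolding torus_dist_def infinity by simp measurable
qed

text \<open>
  The space of torus positions contains points outside the unit cube, where \<open>circ_dist\<close> may be
  negative; they form a null set, but \<open>near\<close> has to exclude them for the ball bounds to hold at every point.
\<close>

definition inbox :: "nat \<Rightarrow> (nat \<Rightarrow> real) \<Rightarrow> bool" where
  "inbox d x \<longleftrightarrow> (\<forall>i<d. 0 \<le> x i \<and> x i < 1)"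

definition near :: "enat \<Rightarrow> nat \<Rightarrow> real \<Rightarrow> (nat \<Rightarrow> real) \<Rightarrow> (nat \<Rightarrow> real) \<Rightarrow> bool" where
  "near p d r x y \<longleftrightarrow> inbox d x \<and> inbox d y \<and> torus_dist p d x y \<le> r"

lemma inbox_measurable [measurable (raw)]:
  assumes [measurable]: "f \<in> measurable M (torus_space d)"
  shows "Measurable.pred M (\<lambda>x. inbox d (f x))"
  unfolding inbox_def by measurable

lemma near_measurable [measurable (raw)]:
  assumes [measurable]: "f \<in> measurable M (torus_space d)" "g \<in> measurable M (torus_space d)"
  shows "Measurable.pred M (\<lambda>x. near p d r (f x) (g x))"
  unfolding near_def by measurable

lemma AE_inbox: "AE x in torus_space d. inbox d x"
proof -
  have "AE x in torus_space d. 0 \<le> x i \<and> x i < 1" if "i < d" for i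
    unfolding torus_space_def
  proof (rule AE_PiM_component)
    show "AE y in uniform_measure lborel {0..<1::real}. 0 \<le> y \<and> y < 1"
      by (rule AE_uniform_measureI) auto
  qed (use that in \<open>auto intro: prob_space_uniform_interval\<close>)
  then have "AE x in torus_space d. \<forall>i\<in>{..<d}. 0 \<le> x i \<and> x i < 1"
    by (intro AE_finite_allI) auto
  then show ?thesis by (auto simp: inbox_def)
qed

section \<open>Comparison of torus balls with cubes\<close>

lemma torus_dist_commute: "torus_dist p d x y = torus_dist p d y x"
  unfolding torus_dist_def by (cases p) (simp_all add: circ_dist_commute[of "x i" "y i" for i])

lemma near_commute: "near p d r x y \<longleftrightarrow> near p d r y x"
  unfolding near_def by (auto simp: torus_dist_commute)

lemma power_powr_inverse: "c \<ge> 0 \<Longrightarrow> q \<ge> 1 \<Longrightarrow> (c ^ q) powr (1 / real q) = (c::real)"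
  by (cases "c = 0") (auto simp: powr_powr simp flip: powr_realpow)

text \<open>A ball lies in the cube of the same radius, since a \<open>p\<close>-norm dominates each
  coordinate.\<close>

lemma circ_dist_le_torus_dist:
  assumes "i < d" "inbox d x" "inbox d y" "p \<ge> 1"
  shows "circ_dist (x i) (y i) \<le> torus_dist p d x y"
proof (cases p)
  case (enat q)
  then have q: "q \<ge> 1" using assms(4) by (simp add: one_enat_def)
  have nn: "0 \<le> circ_dist (x j) (y j)" if "j < d" for j
    using assms that by (intro circ_dist_nonneg) (auto simp: inbox_def)
  have "circ_dist (x i) (y i) = (circ_dist (x i) (y i) ^ q) powr (1 / real q)"
    using nn[OF assms(1)] q by (simp add: power_powr_inverse)
  also have "\<dots> \<le> (\<Sum>i<d. circ_dist (x i) (y i) ^ q) powr (1 / real q)"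
    by (intro powr_mono2 member_le_sum[of i "{..<d}" "\<lambda>i. circ_dist (x i) (y i) ^ q"])
       (use assms nn in auto)
  finally show ?thesis by (simp add: torus_dist_def enat)
next
  case infinity
  then show ?thesis using assms by (auto simp: torus_dist_def intro!: Max_ge)
qed

text \<open>Conversely, a cube lies in the ball whose radius is \<open>d\<close> times larger. For
  finite \<open>q\<close> this follows from \<open>d \<le> d ^ q\<close>; the factor
  \<open>d\<close> serves all norms at once.\<close>

lemma torus_dist_le:
  assumes "inbox d x" "inbox d y" "p \<ge> 1" "d \<ge> 1" "\<And>i. i < d \<Longrightarrow> circ_dist (x i) (y i) \<le> r"
  shows "torus_dist p d x y \<le> real d * r"
proof -
  have nn: "0 \<le> circ_dist (x j) (y j)" if "j < d" for j
    using assms that by (intro circ_dist_nonneg) (auto simp: inbox_def)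
  have r: "r \<ge> 0" using nn[of 0] assms(5)[of 0] assms(4) by simp
  have dr: "r \<le> real d * r" using assms(4) r by (simp add: mult_le_cancel_right1)
  show ?thesis
  proof (cases p)
    case (enat q)
    then have q: "q \<ge> 1" using assms(3) by (simp add: one_enat_def)
    have "(\<Sum>i<d. circ_dist (x i) (y i) ^ q) \<le> (\<Sum>i<d. r ^ q)"
      by (intro sum_mono power_mono) (use nn assms in auto)
    also have "\<dots> \<le> real d ^ q * r ^ q"
      using assms(4) q r by (simp add: mult_right_mono self_le_power)
    also have "\<dots> = (real d * r) ^ q" by (simp add: power_mult_distrib)
    finally have "(\<Sum>i<d. circ_dist (x i) (y i) ^ q) powr (1 / real q) \<le> ((real d * r) ^ q) powr (1 / real q)"
      by (intro powr_mono2) (use nn in \<open>auto intro!: sum_nonneg\<close>)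
    also have "\<dots> = real d * r" using q r by (intro power_powr_inverse) auto
    finally show ?thesis by (simp add: torus_dist_def enat)
  next
    case infinity
    have "Max ((\<lambda>i. circ_dist (x i) (y i)) ` {..<d}) \<le> r"
      using assms(4,5) by (subst Max_le_iff) (auto simp: lessThan_empty_iff)
    then show ?thesis using dr by (simp add: torus_dist_def infinity)
  qed
qed

text \<open>The ball is contained in a product of circular balls of radius \<open>r\<close>. If
  \<open>x\<close> is outside the unit cube, nothing is near it.\<close>

lemma measure_near_le:
  assumes p: "p \<ge> 1" and r: "r \<ge> 0"
  shows "measure (torus_space d) {y \<in> space (torus_space d). near p d r x y} \<le> (2 * r) ^ d"
proof (cases "inbox d x")
  case False
  then show ?thesis using r by (simp add: near_def)
next
  case True
  interpret prob_space "torus_space d" by (rule prob_space_torus)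
  let ?B = "\<Pi>\<^sub>E i\<in>{..<d}. {b \<in> {0..<1}. circ_dist (x i) b \<le> r}"
  have "measure (torus_space d) {y \<in> space (torus_space d). near p d r x y} \<le> measure (torus_space d) ?B"
  proof (rule finite_measure_mono)
    show "{y \<in> space (torus_space d). near p d r x y} \<subseteq> ?B"
    proof
      fix y assume y: "y \<in> {y \<in> space (torus_space d). near p d r x y}"
      then have yb: "inbox d y" and "torus_dist p d x y \<le> r" by (auto simp: near_def)
      then have "circ_dist (x i) (y i) \<le> r" if "i < d" for i
        using circ_dist_le_torus_dist[OF that True yb p] by linarith
      then show "y \<in> ?B"
        using y yb by (auto simp: space_torus inbox_def PiE_iff)
    qed
    show "?B \<in> sets (torus_space d)"
      unfolding torus_space_def by (rule sets_PiM_I_finite) auto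
  qed
  also have "\<dots> = (\<Prod>i<d. measure (uniform_measure lborel {0..<1}) {b \<in> {0..<1}. circ_dist (x i) b \<le> r})"
    unfolding torus_space_def by (rule measure_PiM_PiE) (auto intro: prob_space_uniform_interval)
  also have "\<dots> \<le> (\<Prod>i<d. 2 * r)"
    using True by (intro prod_mono conjI measure_circ_ball_le) (auto simp: inbox_def r)
  finally show ?thesis by simp
qed

text \<open>The ball contains the product of circular balls of radius \<open>r / d\<close>; the
  bound on \<open>r\<close> makes this radius at most \<open>1/2\<close>.\<close>

lemma measure_near_ge:
  assumes p: "p \<ge> 1" and d: "d \<ge> 1" and r: "0 \<le> r" "r \<le> real d / 2" and x: "inbox d x" and [measurable]: "x \<in> space (torus_space d)"
  shows "measure (torus_space d) {y \<in> space (torus_space d). near p d r x y} \<ge> (r / real d) ^ d"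
proof -
  interpret prob_space "torus_space d" by (rule prob_space_torus)
  let ?B = "\<Pi>\<^sub>E i\<in>{..<d}. {b \<in> {0..<1}. circ_dist (x i) b \<le> r / d}"
  have "(r / real d) ^ d = (\<Prod>i<d. r / real d)" by simp
  also have "\<dots> \<le> (\<Prod>i<d. measure (uniform_measure lborel {0..<1}) {b \<in> {0..<1}. circ_dist (x i) b \<le> r / d})"
    using x r d by (intro prod_mono conjI measure_circ_ball_ge) (auto simp: inbox_def field_simps)
  also have "\<dots> = measure (torus_space d) ?B"
    unfolding torus_space_def by (rule measure_PiM_PiE[symmetric]) (auto intro: prob_space_uniform_interval)
  also have "\<dots> \<le> measure (torus_space d) {y \<in> space (torus_space d). near p d r x y}"
  proof (rule finite_measure_mono)
    show "?B \<subseteq> {y \<in> space (torus_space d). near p d r x y}"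
    proof
      fix y assume y: "y \<in> ?B"
      then have yb: "inbox d y" by (auto simp: inbox_def PiE_iff)
      have "torus_dist p d x y \<le> real d * (r / real d)"
        using y by (intro torus_dist_le[OF x yb p d]) (auto simp: PiE_iff)
      then show "y \<in> {y \<in> space (torus_space d). near p d r x y}"
        using y yb x d by (auto simp: near_def space_torus PiE_iff)
    qed
  qed measurable
  finally show ?thesis .
qed

section \<open>Balls and shells scaled by the weight of a variable\<close>

lemma near_mono: "near p d r x y \<Longrightarrow> r \<le> r' \<Longrightarrow> near p d r' x y"
  by (auto simp: near_def)

lemma powr_inverse_power: "c > 0 \<Longrightarrow> d \<ge> 1 \<Longrightarrow> (c powr (1 / real d)) ^ d = c"
  by (simp add: powr_powr flip: powr_realpow)

text \<open>Scaling the radius by the \<open>d\<close>-th root of \<open>w\<close> makes the volume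
  linear in \<open>w\<close>, so that volumes summed over all variables are controlled by the total
  weight.\<close>

lemma measure_weighted_near_le:
  assumes "p \<ge> 1" "d \<ge> 1" "r \<ge> 0" "w > 0"
  shows "measure (torus_space d) {y \<in> space (torus_space d). near p d (r * w powr (1 / real d)) x y}
           \<le> (2 * r) ^ d * w"
  using measure_near_le[of p "r * w powr (1 / real d)" d x] assms
  by (simp add: power_mult_distrib powr_inverse_power)

text \<open>With radius ratio \<open>4 * d\<close> the outer ball contains a cube set of volume at
  least \<open>(4 * r) ^ d * w\<close>, while the inner ball has volume at most
  \<open>(2 * r) ^ d * w\<close>. The difference suffices because
  \<open>4 ^ d - 2 ^ d \<ge> 1\<close>.\<close>

lemma measure_weighted_shell_ge:
  assumes p: "p \<ge> 1" and d: "d \<ge> 1" and r: "0 \<le> r" and w: "w > 0" and x: "inbox d x" and [measurable]: "x \<in> space (torus_space d)"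
    and small: "(2 * (4 * real d * r)) ^ d * w \<le> 1"
  shows "measure (torus_space d) {y \<in> space (torus_space d).
            near p d (4 * real d * r * w powr (1 / real d)) x y \<and> \<not> near p d (r * w powr (1 / real d)) x y}
         \<ge> r ^ d * w"
proof -
  interpret prob_space "torus_space d" by (rule prob_space_torus)
  let ?R = "w powr (1 / real d)"
  let ?N = "\<lambda>r. {y \<in> space (torus_space d). near p d (r * ?R) x y}"
  have d1: "1 \<le> real d" using d by simp
  have "(2 * (4 * real d * r * ?R)) ^ d \<le> 1"
    using small w d by (simp add: power_mult_distrib powr_inverse_power)
  \<comment> \<open>Volume at most 1 for the enclosing cube means side at most 1, which yields the
    radius restriction of the lower ball bound.\<close>
  then have "2 * (4 * real d * r * ?R) \<le> 1"
    using d r by (subst (asm) power_le_one_iff) auto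
  then have le: "4 * real d * r * ?R \<le> real d / 2" using d1 by linarith
  have "(4 * r) ^ d * w = (4 * real d * r * ?R / real d) ^ d"
    using d w by (simp add: power_mult_distrib powr_inverse_power)
  also have "\<dots> \<le> measure (torus_space d) (?N (4 * real d * r))"
    by (rule measure_near_ge[OF p d _ le x]) (use r assms(6) in auto)
  finally have a: "(4 * r) ^ d * w \<le> measure (torus_space d) (?N (4 * real d * r))" .
  have b: "measure (torus_space d) (?N r) \<le> (2 * r) ^ d * w"
    by (rule measure_weighted_near_le[OF p d r w])
  have "1 * r \<le> 4 * real d * r" using d r by (intro mult_right_mono) auto
  then have sub: "?N r \<subseteq> ?N (4 * real d * r)"
    by (auto elim!: near_mono intro!: mult_right_mono)
  have "(2::real) ^ d + 1 \<le> 4 ^ d"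
  proof -
    have "(2::real) ^ d \<ge> 2" using d by (metis one_le_numeral power_increasing power_one_right)
    then have "(2::real) ^ d * 2 \<le> 2 ^ d * 2 ^ d" by (intro mult_left_mono) auto
    then show ?thesis using \<open>(2::real) ^ d \<ge> 2\<close> by (simp flip: power_mult_distrib)
  qed
  then have "((2::real) ^ d + 1) * (r ^ d * w) \<le> 4 ^ d * (r ^ d * w)"
    using r w by (intro mult_right_mono) auto
  then have "r ^ d * w \<le> (4 * r) ^ d * w - (2 * r) ^ d * w"
    by (simp add: power_mult_distrib algebra_simps)
  also have "\<dots> \<le> measure (torus_space d) (?N (4 * real d * r)) - measure (torus_space d) (?N r)"
    using a b by linarith
  also have "\<dots> = measure (torus_space d) (?N (4 * real d * r) - ?N r)"
    by (rule finite_measure_Diff[symmetric, OF _ _ sub]) measurable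
  also have "?N (4 * real d * r) - ?N r = {y \<in> space (torus_space d).
            near p d (4 * real d * r * ?R) x y \<and> \<not> near p d (r * ?R) x y}" by auto
  finally show ?thesis .
qed

section \<open>Connection weights as decreasing powers of the rescaled distance\<close>

lemma conn_weight_eq:
  assumes "torus_dist p d x y > 0" "w > 0" "d \<ge> 1" "T > 0"
  shows "conn_weight T d p w x y = (torus_dist p d x y / w powr (1 / real d)) powr (- real d / T)"
proof -
  have "w / torus_dist p d x y ^ d = (torus_dist p d x y / w powr (1 / real d)) powr (- real d)"
    using assms by (simp add: powr_minus_divide powr_realpow power_divide powr_inverse_power)
  then show ?thesis
    by (simp add: conn_weight_def powr_powr)
qed

lemma conn_weight_less:
  assumes "torus_dist p d x y > r * w powr (1 / real d)" "r > 0" "w > 0" "d \<ge> 1" "T > 0"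
  shows "conn_weight T d p w x y < r powr (- real d / T)"
proof -
  have pos: "r * w powr (1 / real d) > 0" using assms by simp
  then have "torus_dist p d x y > 0" using assms(1) by linarith
  then show ?thesis
    using assms by (simp add: conn_weight_eq) (intro powr_less_mono2_neg, auto simp: field_simps)
qed

text \<open>At distance 0 the division makes \<open>conn_weight\<close> equal to 0 instead of
  infinite, hence the lower bound asks for a positive distance.\<close>

lemma conn_weight_ge:
  assumes "torus_dist p d x y \<le> r * w powr (1 / real d)" "torus_dist p d x y > 0"
    "w > 0" "d \<ge> 1" "T > 0"
  shows "conn_weight T d p w x y \<ge> r powr (- real d / T)"
  using assms by (simp add: conn_weight_eq) (intro powr_mono2', auto simp: field_simps)

text \<open>The near part is cut off because the weight has a singularity of order
  \<open>d / T > d\<close> at the variable, which is not integrable.\<close>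

definition tail_weight :: "real \<Rightarrow> nat \<Rightarrow> enat \<Rightarrow> real \<Rightarrow> real \<Rightarrow> (nat \<Rightarrow> real) \<Rightarrow> (nat \<Rightarrow> real) \<Rightarrow> real" where
  "tail_weight T d p r w x y =
     (if inbox d x \<and> inbox d y \<and> \<not> near p d (r * w powr (1 / real d)) x y
      then conn_weight T d p w x y else 0)"

lemma tail_weight_measurable [measurable (raw)]:
  assumes [measurable]: "f \<in> measurable M (torus_space d)" "g \<in> measurable M (torus_space d)"
  shows "(\<lambda>x. tail_weight T d p r w (f x) (g x)) \<in> borel_measurable M"
  unfolding tail_weight_def conn_weight_def by measurable

lemma ennreal_le_suminf: "f i \<le> (\<Sum>i. f i)" for f :: "nat \<Rightarrow> ennreal"
  using sum_le_suminf[of f "{i}"] by (simp add: summableI)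

text \<open>Dyadic decomposition of the distance; the resulting geometric series converges since \<open>T < 1\<close>.\<close>

lemma nn_integral_tail_weight_le:
  assumes p: "p \<ge> 1" and d: "d \<ge> 1" and r: "r > 0" and w: "w > 0" and T: "0 < T" "T < 1"
    and [measurable]: "y \<in> space (torus_space d)"
  shows "(\<integral>\<^sup>+x. ennreal (tail_weight T d p r w x y) \<partial>torus_space d)
       \<le> ennreal (4 ^ d / (1 - 2 powr (real d - real d / T)) * (r ^ d * w) * r powr (- real d / T))"
proof -
  interpret prob_space "torus_space d" by (rule prob_space_torus)
  let ?R = "w powr (1 / real d)"
  \<comment> \<open>The ratio of the geometric series: doubling the distance multiplies the volume
    by \<open>2 ^ d\<close> and the weight by \<open>2 powr (- d / T)\<close>.\<close>
  define \<beta> where "\<beta> = 2 powr (real d - real d / T)"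
  have \<beta>: "0 < \<beta>" "\<beta> < 1"
  proof -
    have "real d - real d / T < 0" using d T by (simp add: field_simps)
    then have "2 powr (real d - real d / T) < 2 powr 0" by (intro powr_less_mono) auto
    then show "0 < \<beta>" "\<beta> < 1" by (auto simp: \<beta>_def)
  qed
  let ?N = "\<lambda>i::nat. {x \<in> space (torus_space d). near p d (2 ^ Suc i * r * ?R) y x}"
  have "(\<integral>\<^sup>+x. ennreal (tail_weight T d p r w x y) \<partial>torus_space d)
     \<le> (\<integral>\<^sup>+x. (\<Sum>i. ennreal ((2 ^ i * r) powr (- real d / T)) * indicator (?N i) x) \<partial>torus_space d)"
  proof (rule nn_integral_mono)
    fix x assume xs: "x \<in> space (torus_space d)"
    let ?F = "\<lambda>i. ennreal ((2 ^ i * r) powr (- real d / T)) * indicator (?N i) x"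
    show "ennreal (tail_weight T d p r w x y) \<le> (\<Sum>i. ?F i)"
    proof (cases "inbox d x \<and> inbox d y \<and> \<not> near p d (r * ?R) x y")
      case False
      then show ?thesis by (auto simp: tail_weight_def)
    next
      case True
      let ?D = "torus_dist p d x y"
      have D: "?D > r * ?R" using True by (auto simp: near_def)
      have rR: "r * ?R > 0" using r w by simp
      obtain i0 where i0: "?D / (r * ?R) < 2 ^ i0"
        using real_arch_pow[of 2 "?D / (r * ?R)"] by auto
      \<comment> \<open>The least dyadic scale reaching \<open>x\<close> is not 0, as
        \<open>x\<close> is outside the first ball. Its predecessor \<open>j\<close> is exceeded by
        the distance, which bounds the weight, while scale \<open>Suc j\<close> places
        \<open>x\<close> in \<open>?N j\<close>.\<close>
      define i where "i = (LEAST i. ?D \<le> 2 ^ i * (r * ?R))"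
      have ex: "?D \<le> 2 ^ i0 * (r * ?R)" using i0 rR by (simp add: field_simps)
      have i: "?D \<le> 2 ^ i * (r * ?R)" unfolding i_def by (rule LeastI[of _ i0]) (rule ex)
      have "i \<noteq> 0" using i D by (intro notI) simp
      then obtain j where j: "i = Suc j" by (cases i) auto
      have "\<not> ?D \<le> 2 ^ j * (r * ?R)"
        by (rule not_less_Least) (simp add: j i_def[symmetric])
      then have "tail_weight T d p r w x y \<le> (2 ^ j * r) powr (- real d / T)"
        using True conn_weight_less[of "2 ^ j * r" w d p x y T] r w d T
        by (simp add: tail_weight_def mult.assoc)
      moreover have "x \<in> ?N j"
        using xs i True j by (auto simp: near_def mult.assoc torus_dist_commute)
      ultimately have "ennreal (tail_weight T d p r w x y) \<le> ?F j"
        by (simp add: ennreal_leI)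
      also have "\<dots> \<le> (\<Sum>i. ?F i)"
        by (rule ennreal_le_suminf)
      finally show ?thesis .
    qed
  qed
  also have "\<dots> = (\<Sum>i. (\<integral>\<^sup>+x. ennreal ((2 ^ i * r) powr (- real d / T)) * indicator (?N i) x \<partial>torus_space d))"
    by (rule nn_integral_suminf) measurable
  also have "\<dots> = (\<Sum>i. ennreal ((2 ^ i * r) powr (- real d / T)) * emeasure (torus_space d) (?N i))"
    by (intro suminf_cong nn_integral_cmult_indicator) measurable
  also have "\<dots> \<le> (\<Sum>i. ennreal (4 ^ d * (r ^ d * w) * r powr (- real d / T) * \<beta> ^ i))"
  proof (intro suminf_le)
    fix i :: nat
    have "ennreal ((2 ^ i * r) powr (- real d / T)) * emeasure (torus_space d) (?N i)
        \<le> ennreal ((2 ^ i * r) powr (- real d / T)) * ennreal ((2 * (2 ^ Suc i * r)) ^ d * w)"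
      unfolding emeasure_eq_measure
      by (intro mult_left_mono ennreal_leI measure_weighted_near_le) (use p d r w in auto)
    also have "\<dots> = ennreal ((2 ^ i * r) powr (- real d / T) * ((2 * (2 ^ Suc i * r)) ^ d * w))"
      using r w by (simp add: ennreal_mult)
    also have "(2 ^ i * r) powr (- real d / T) * ((2 * (2 ^ Suc i * r)) ^ d * w)
        = 4 ^ d * (r ^ d * w) * r powr (- real d / T) * \<beta> ^ i"
    proof -
      have "(2 ^ i * r) powr (- real d / T) = 2 powr (- real d / T * real i) * r powr (- real d / T)"
        using r by (simp add: powr_mult powr_powr mult.commute flip: powr_realpow)
      moreover have "(2 * (2 ^ Suc i * r)) ^ d = 4 ^ d * r ^ d * 2 powr (real d * real i)"
      proof -
        have "(2 * (2 ^ Suc i * r)) ^ d = (4 * r * 2 ^ i) ^ d" by (simp add: mult_ac)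
        also have "\<dots> = 4 ^ d * r ^ d * (2 ^ i) ^ d" by (simp add: power_mult_distrib)
        also have "((2::real) ^ i) ^ d = 2 powr (real d * real i)"
          by (simp add: powr_powr mult.commute flip: powr_realpow)
        finally show ?thesis .
      qed
      moreover have "\<beta> ^ i = 2 powr (real d * real i) * 2 powr (- real d / T * real i)"
        by (simp add: \<beta>_def powr_powr algebra_simps flip: powr_realpow powr_add)
      ultimately show ?thesis by (simp add: mult_ac)
    qed
    finally show "ennreal ((2 ^ i * r) powr (- real d / T)) * emeasure (torus_space d) (?N i)
        \<le> ennreal (4 ^ d * (r ^ d * w) * r powr (- real d / T) * \<beta> ^ i)" .
  qed (auto intro: summableI)
  also have "\<dots> = ennreal (\<Sum>i. 4 ^ d * (r ^ d * w) * r powr (- real d / T) * \<beta> ^ i)"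
    by (rule suminf_ennreal2) (use \<beta> r w in \<open>auto intro!: summable_mult summable_geometric\<close>)
  also have "(\<Sum>i. 4 ^ d * (r ^ d * w) * r powr (- real d / T) * \<beta> ^ i)
      = 4 ^ d * (r ^ d * w) * r powr (- real d / T) * (1 / (1 - \<beta>))"
    using \<beta> by (subst suminf_mult) (auto intro!: summable_geometric simp: suminf_geometric)
  finally show ?thesis by (simp add: \<beta>_def mult_ac)
qed

section \<open>Separated clause positions\<close>

text \<open>The Weierstrass product inequality. It bounds from below the probability that
  independently placed variables all avoid their balls.\<close>

lemma prod_one_minus_ge:
  fixes b :: "'a \<Rightarrow> real"
  assumes "finite A" "\<And>i. i \<in> A \<Longrightarrow> 0 \<le> b i \<and> b i \<le> 1"
  shows "(\<Prod>i\<in>A. 1 - b i) \<ge> 1 - (\<Sum>i\<in>A. b i)"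
  using assms
proof (induction A rule: finite_induct)
  case (insert i A)
  have P: "0 \<le> (\<Prod>i\<in>A. 1 - b i)" "(\<Prod>i\<in>A. 1 - b i) \<le> 1"
    using insert.prems by (auto intro!: prod_nonneg prod_le_1)
  have "b i * (\<Prod>i\<in>A. 1 - b i) \<le> b i * 1"
    using insert.prems P by (intro mult_left_mono) auto
  then show ?case using insert by (simp add: algebra_simps)
qed simp

text \<open>
  A \<open>p\<close>-norm ball is only sandwiched between two cubes whose sides differ by a factor \<open>d\<close>; with
  ratio \<open>4d\<close> between consecutive radii the inner cube of one ball beats the outer cube of the previous.
\<close>

definition rad :: "nat \<Rightarrow> real \<Rightarrow> nat \<Rightarrow> real" where
  "rad d s j = (4 * real d) ^ j * s"

definition wnear :: "enat \<Rightarrow> nat \<Rightarrow> (nat \<Rightarrow> real) \<Rightarrow> real \<Rightarrow> (nat \<Rightarrow> real) \<Rightarrow> nat \<Rightarrow> (nat \<Rightarrow> real) \<Rightarrow> bool" where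
  "wnear p d w r x v y \<longleftrightarrow> near p d (r * w v powr (1 / real d)) x y"

text \<open>Shell \<open>j\<close> lies between the radii of index \<open>j\<close> and
  \<open>Suc j\<close>, so \<open>u\<close> lists the chosen variables from the inside out, by
  decreasing connection weight. Shells are disjoint, which makes \<open>u\<close> injective.
  Extensional functions form a finite set, so measurability reduces to finite unions.\<close>

definition layered ::
  "enat \<Rightarrow> nat \<Rightarrow> nat \<Rightarrow> (nat \<Rightarrow> real) \<Rightarrow> nat \<Rightarrow> real \<Rightarrow> (nat \<Rightarrow> nat \<Rightarrow> real) \<Rightarrow> (nat \<Rightarrow> real) \<Rightarrow> bool" where
  "layered p d k w n s xs x \<longleftrightarrow>
     (\<exists>u\<in>{..<k} \<rightarrow>\<^sub>E {..<n}.
        (\<forall>j<k. wnear p d w (rad d s (Suc j)) x (u j) (xs (u j)) \<and>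
               \<not> wnear p d w (rad d s j) x (u j) (xs (u j))) \<and>
        (\<forall>v<n. v \<notin> u ` {..<k} \<longrightarrow> \<not> wnear p d w (rad d s k) x v (xs v)))"

abbreviation var_space :: "nat \<Rightarrow> nat \<Rightarrow> (nat \<Rightarrow> nat \<Rightarrow> real) measure" where
  "var_space d n \<equiv> PiM {..<n} (\<lambda>_. torus_space d)"

lemma prob_space_vars: "prob_space (var_space d n)"
  by (rule prob_space_PiM) (rule prob_space_torus)

lemma vars_component_measurable:
  assumes "v < n" "f \<in> measurable N (var_space d n)"
  shows "(\<lambda>z. f z v) \<in> measurable N (torus_space d)"
  by (rule measurable_compose[OF assms(2) measurable_component_singleton]) (use assms(1) in simp)

lemma wnear_measurable [measurable (raw)]:
  assumes "f \<in> measurable M (torus_space d)" "g \<in> measurable M (torus_space d)"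
  shows "Measurable.pred M (\<lambda>z. wnear p d w r (f z) v (g z))"
  unfolding wnear_def using assms by measurable

lemma layered_measurable [measurable (raw)]:
  assumes f: "f \<in> measurable N (var_space d n)" and g: "g \<in> measurable N (torus_space d)"
  shows "Measurable.pred N (\<lambda>z. layered p d k w n s (f z) (g z))"
proof -
  note m = wnear_measurable[OF g vars_component_measurable[OF _ f]]
  show ?thesis
    unfolding layered_def
    by (intro pred_intros_finite pred_intros_logic pred_intros_countable pred_intros_imp' finite_PiE
              finite_lessThan m) (auto simp: PiE_iff)
qed

text \<open>The hypothesis \<open>small\<close> says that the cubes enclosing the largest weighted
  balls have total volume at most \<open>1/2\<close>. It fixes the scale of \<open>s\<close>, and it
  ensures that all variables are outside their balls with probability at least
  \<open>1/2\<close>.\<close>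

locale geometric_instance =
  fixes d k n :: nat and p :: enat and T s :: real and w :: "nat \<Rightarrow> real"
  assumes d: "d \<ge> 1" and p: "p \<ge> 1" and T: "0 < T" "T < 1" and s: "s > 0"
    and w: "\<And>v. v < n \<Longrightarrow> w v \<ge> 1"
    and small: "(2 * rad d s k) ^ d * (\<Sum>v<n. w v) \<le> 1 / 2"
begin

abbreviation "\<rho> \<equiv> rad d s"
abbreviation "near_var \<equiv> wnear p d w"
abbreviation "lay \<equiv> layered p d k w n s"

text \<open>The volume of the enclosing cube, hence an upper bound for the volume of the ball of
  \<open>v\<close> at the largest radius.\<close>

definition ball_vol :: "nat \<Rightarrow> real" where "ball_vol v = (2 * \<rho> k) ^ d * w v"

lemma d1: "1 \<le> real d" using d by simp

lemma rad_pos: "\<rho> j > 0"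
  using s d by (simp add: rad_def)

lemma rad_mono: "i \<le> j \<Longrightarrow> \<rho> i \<le> \<rho> j"
  unfolding rad_def using s d1 by (intro mult_right_mono power_increasing) auto

lemma rad_Suc: "\<rho> (Suc j) = 4 * real d * \<rho> j"
  by (simp add: rad_def)

lemma near_var_mono: "near_var (\<rho> i) x v y \<Longrightarrow> i \<le> j \<Longrightarrow> near_var (\<rho> j) x v y"
  unfolding wnear_def using rad_mono by (elim near_mono) (auto intro!: mult_right_mono)

lemma w_pos: "v < n \<Longrightarrow> w v > 0" using w[of v] by linarith

lemma ball_vol_nonneg: "v < n \<Longrightarrow> 0 \<le> ball_vol v"
  using w_pos[of v] rad_pos[of k] by (simp add: ball_vol_def)

lemma sum_ball_vol_le: "(\<Sum>v<n. ball_vol v) \<le> 1 / 2"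
  using small by (simp add: ball_vol_def sum_distrib_left)

lemma ball_vol_le: assumes "v < n" shows "ball_vol v \<le> 1 / 2"
proof -
  have "ball_vol v \<le> (\<Sum>v<n. ball_vol v)"
    by (rule member_le_sum) (use assms ball_vol_nonneg in auto)
  then show ?thesis using sum_ball_vol_le by linarith
qed

lemma measure_near_var_le:
  assumes "v < n"
  shows "measure (torus_space d) {y \<in> space (torus_space d). near_var (\<rho> k) x v y} \<le> ball_vol v"
  unfolding wnear_def ball_vol_def
  by (rule measure_weighted_near_le) (use p d rad_pos[of k] w_pos assms in auto)

text \<open>The same bound with the roles exchanged: the variable is fixed and the clause position
  varies.\<close>

lemma measure_near_var_le':
  assumes "v < n"
  shows "measure (torus_space d) {x \<in> space (torus_space d). near_var (\<rho> k) x v y} \<le> ball_vol v"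
  using measure_near_var_le[OF assms, of y] unfolding wnear_def by (simp only: near_commute[of p d _ y])

text \<open>A variable outside the largest radius cannot be one of the \<open>u j\<close>. While it
  stays outside, its position enters no condition other than being far.\<close>

lemma layered_update:
  assumes "lay xs x" "\<not> near_var (\<rho> k) x v (xs v)" "\<not> near_var (\<rho> k) x v y"
  shows "lay (xs(v := y)) x"
proof -
  obtain u where u: "u \<in> {..<k} \<rightarrow>\<^sub>E {..<n}"
     "\<And>j. j < k \<Longrightarrow> near_var (\<rho> (Suc j)) x (u j) (xs (u j))"
     "\<And>j. j < k \<Longrightarrow> \<not> near_var (\<rho> j) x (u j) (xs (u j))"
     "\<And>v. v < n \<Longrightarrow> v \<notin> u ` {..<k} \<Longrightarrow> \<not> near_var (\<rho> k) x v (xs v)"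
    using assms(1) unfolding layered_def by blast
  have "u j \<noteq> v" if "j < k" for j
    using u(2)[OF that] near_var_mono[of "Suc j" x "u j" "xs (u j)" k] that assms(2) by auto
  then show ?thesis
    unfolding layered_def using u assms(3) by (intro bexI[of _ u]) auto
qed

section \<open>Influence of one variable on the volume of layered clause positions\<close>

definition layered_vol :: "(nat \<Rightarrow> nat \<Rightarrow> real) \<Rightarrow> real" where
  "layered_vol xs = measure (torus_space d) {x \<in> space (torus_space d). lay xs x}"

lemma layered_sets:
  assumes "xs \<in> space (var_space d n)"
  shows "{x \<in> space (torus_space d). lay xs x} \<in> sets (torus_space d)"
  using assms by measurable

lemma space_vars_component: "xs \<in> space (var_space d n) \<Longrightarrow> v < n \<Longrightarrow> xs v \<in> space (torus_space d)"
  by (auto simp: space_PiM PiE_iff)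

text \<open>Only clause positions near the old or the new position of \<open>v\<close> can lose the
  property. These form two balls, each of volume at most \<open>ball_vol v\<close>.\<close>

lemma layered_vol_update_le:
  assumes xs: "xs \<in> space (var_space d n)" and v: "v < n" and y: "y \<in> space (torus_space d)"
  shows "layered_vol xs \<le> layered_vol (xs(v := y)) + 2 * ball_vol v"
proof -
  interpret prob_space "torus_space d" by (rule prob_space_torus)
  have xs': "xs(v := y) \<in> space (var_space d n)"
    using xs v y by (auto simp: space_PiM PiE_iff extensional_def)
  let ?N = "\<lambda>y. {x \<in> space (torus_space d). near_var (\<rho> k) x v y}"
  have N: "?N y \<in> sets (torus_space d)" if "y \<in> space (torus_space d)" for y
    using that by measurable
  have "layered_vol xs \<le> measure (torus_space d) ({x \<in> space (torus_space d). lay (xs(v := y)) x} \<union> ?N (xs v) \<union> ?N y)"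
    unfolding layered_vol_def
    by (rule finite_measure_mono)
       (use layered_update layered_sets[OF xs'] N[OF y] N[OF space_vars_component[OF xs v]] in auto)
  also have "\<dots> \<le> layered_vol (xs(v := y)) + measure (torus_space d) (?N (xs v)) + measure (torus_space d) (?N y)"
    unfolding layered_vol_def
    by (intro order_trans[OF measure_Un_le] add_mono order_refl)
       (use layered_sets[OF xs'] N[OF y] N[OF space_vars_component[OF xs v]] in auto)
  also have "\<dots> \<le> layered_vol (xs(v := y)) + 2 * ball_vol v"
    using measure_near_var_le'[OF v, of "xs v"] measure_near_var_le'[OF v, of y] by linarith
  finally show ?thesis .
qed

lemma layered_vol_bounded_diff:
  assumes xs: "xs \<in> space (var_space d n)" and v: "v < n" and y: "y \<in> space (torus_space d)"
  shows "\<bar>layered_vol (xs(v := y)) - layered_vol xs\<bar> \<le> 2 * ball_vol v"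
proof -
  have xs': "xs(v := y) \<in> space (var_space d n)"
    using xs v y by (auto simp: space_PiM PiE_iff extensional_def)
  show ?thesis
    \<comment> \<open>The reverse inequality comes from moving \<open>v\<close> back to its old
      position.\<close>
    using layered_vol_update_le[OF xs v y] layered_vol_update_le[OF xs' v space_vars_component[OF xs v]]
    by (simp add: abs_le_iff)
qed

lemma layered_vol_measurable [measurable]: "layered_vol \<in> borel_measurable (var_space d n)"
proof -
  interpret prob_space "torus_space d" by (rule prob_space_torus)
  have "(\<lambda>xs. measure (torus_space d) {x \<in> space (torus_space d). lay xs x}) \<in> borel_measurable (var_space d n)"
    by measurable
  then show ?thesis by (simp add: layered_vol_def[abs_def])
qed

lemma layered_vol_bounds: "0 \<le> layered_vol xs" "layered_vol xs \<le> 1"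
  unfolding layered_vol_def by (auto intro: prob_space.prob_le_1[OF prob_space_torus])

text \<open>
  The variables are split into \<open>k\<close> blocks of size \<open>h\<close>. Placing one variable of block \<open>j\<close> into shell \<open>j\<close> and
  all others far away gives \<open>h\<close> to the power \<open>k\<close> disjoint product events.
\<close>

lemma measure_layered_ge:
  assumes x: "x \<in> space (torus_space d)" "inbox d x" and h: "h * k \<le> n"
  shows "measure (var_space d n) {xs \<in> space (var_space d n). lay xs x} \<ge> (real h * s ^ d) ^ k / 2"
proof -
  interpret V: prob_space "var_space d n" by (rule prob_space_vars)
  interpret Q: prob_space "torus_space d" by (rule prob_space_torus)
  note [measurable] = x(1)
  define out where "out = (\<lambda>v. {y \<in> space (torus_space d). \<not> near_var (\<rho> k) x v y})"
  define sh where "sh = (\<lambda>j v. {y \<in> space (torus_space d). near_var (\<rho> (Suc j)) x v y \<and> \<not> near_var (\<rho> j) x v y})"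
  \<comment> \<open>Block \<open>v div h\<close> contains \<open>v\<close>. The choice function
    \<open>g\<close> puts its variable of block \<open>j\<close> into shell \<open>j\<close>; all
    other variables, including those of index at least \<open>h * k\<close>, are put outside the
    largest radius.\<close>
  define box where "box = (\<lambda>g v. if v < h * k \<and> g (v div h) = v then sh (v div h) v else out v)"
  define G where "G = (\<Pi>\<^sub>E j\<in>{..<k}. {j * h..<Suc j * h})"
  have [measurable]: "out v \<in> sets (torus_space d)" "sh j v \<in> sets (torus_space d)" for j v
    unfolding out_def sh_def by measurable
  have box_sets: "box g v \<in> sets (torus_space d)" for g v
    unfolding box_def by auto
  have finG: "finite G" unfolding G_def by (auto intro!: finite_PiE)
  have cardG: "card G = h ^ k" unfolding G_def by (subst card_PiE) auto
  have gdiv: "g j div h = j" if "g \<in> G" "j < k" for g j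
  proof -
    have "j * h \<le> g j" "g j < Suc j * h" using that by (auto simp: G_def PiE_iff)
    then show ?thesis by (intro div_nat_eqI) (auto simp: mult.commute)
  qed
  have ghk: "g j < h * k" if "g \<in> G" "j < k" for g j
  proof -
    have "g j < Suc j * h" using that by (auto simp: G_def PiE_iff)
    also have "\<dots> \<le> k * h" using that by (intro mult_right_mono) auto
    finally show ?thesis by (simp add: mult.commute)
  qed
  have img: "v < h * k \<and> g (v div h) = v \<longleftrightarrow> v \<in> g ` {..<k}" if g: "g \<in> G" for g v
  proof
    assume v: "v < h * k \<and> g (v div h) = v"
    then have "v div h < k" by (simp add: less_mult_imp_div_less mult.commute)
    then show "v \<in> g ` {..<k}" using v by (metis imageI lessThan_iff)
  next
    assume "v \<in> g ` {..<k}"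
    then show "v < h * k \<and> g (v div h) = v" using gdiv[OF g] ghk[OF g] by auto
  qed
  have sub: "PiE {..<n} (box g) \<subseteq> {xs \<in> space (var_space d n). lay xs x}" if g: "g \<in> G" for g
  proof
    fix xs assume xs: "xs \<in> PiE {..<n} (box g)"
    have gu: "g \<in> {..<k} \<rightarrow>\<^sub>E {..<n}"
      using ghk[OF g] h g by (auto simp: G_def PiE_iff intro: less_le_trans)
    have xb: "xs v \<in> box g v" if "v < n" for v using xs that by (auto simp: PiE_iff)
    have "xs (g j) \<in> sh j (g j)" if "j < k" for j
      using xb[of "g j"] ghk[OF g that] gdiv[OF g that] h by (simp add: box_def)
    moreover have "xs v \<in> out v" if "v < n" "v \<notin> g ` {..<k}" for v
      using xb[OF that(1)] img[OF g, of v] that(2) by (auto simp: box_def)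
    ultimately have "lay xs x"
      unfolding layered_def using gu by (intro bexI[of _ g]) (auto simp: sh_def out_def)
    moreover have "xs \<in> space (var_space d n)"
      using xs sets.sets_into_space[OF box_sets] by (auto simp: space_PiM PiE_iff)
    ultimately show "xs \<in> {xs \<in> space (var_space d n). lay xs x}" by simp
  qed
  have disj: "disjoint_family_on (\<lambda>g. PiE {..<n} (box g)) G"
    unfolding disjoint_family_on_def
  proof (intro ballI impI equals0I)
    fix g g' xs assume g: "g \<in> G" and g': "g' \<in> G" and ne: "g \<noteq> g'"
      and xs: "xs \<in> PiE {..<n} (box g) \<inter> PiE {..<n} (box g')"
    \<comment> \<open>Where the choices differ, the variable \<open>g j\<close> would be in shell
      \<open>j\<close> according to \<open>g\<close> and beyond the largest radius according to
      \<open>g'\<close>.\<close>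
    obtain j where j: "j < k" "g j \<noteq> g' j"
      using ne PiE_ext[of g "{..<k}" "\<lambda>j. {j * h..<Suc j * h}" g'] g g' by (auto simp: G_def)
    have lt: "g j < n" using ghk[OF g j(1)] h by linarith
    have "xs (g j) \<in> sh j (g j)"
      using xs lt ghk[OF g j(1)] gdiv[OF g j(1)] by (auto simp: PiE_iff box_def dest!: bspec[of _ _ "g j"])
    moreover have "xs (g j) \<in> out (g j)"
      using xs lt gdiv[OF g j(1)] j(2) by (auto simp: PiE_iff box_def dest!: bspec[of _ _ "g j"])
    ultimately show False
      using near_var_mono[of "Suc j" x "g j" "xs (g j)" k] j(1) by (auto simp: sh_def out_def)
  qed
  have out_ge: "measure (torus_space d) (out v) \<ge> 1 - ball_vol v" if "v < n" for v
  proof -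
    have "out v = space (torus_space d) - {y \<in> space (torus_space d). near_var (\<rho> k) x v y}"
      by (auto simp: out_def)
    then have "measure (torus_space d) (out v) = 1 - measure (torus_space d) {y \<in> space (torus_space d). near_var (\<rho> k) x v y}"
      by (simp only:) (rule Q.prob_compl, measurable)
    then show ?thesis using measure_near_var_le[OF that, of x] by linarith
  qed
  have sh_ge: "measure (torus_space d) (sh j v) \<ge> s ^ d" if "v < n" "j < k" for j v
  proof -
    have "(2 * (4 * real d * \<rho> j)) ^ d * w v = (2 * \<rho> (Suc j)) ^ d * w v" by (simp add: rad_Suc)
    also have "\<dots> \<le> ball_vol v"
      unfolding ball_vol_def using rad_mono[of "Suc j" k] rad_pos[of "Suc j"] w_pos that
      by (intro mult_right_mono power_mono) (auto intro: less_imp_le)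
    finally have sm: "(2 * (4 * real d * \<rho> j)) ^ d * w v \<le> 1" using ball_vol_le[OF that(1)] by linarith
    \<comment> \<open>Every shell is at least as large as the innermost one for a variable of weight
      1.\<close>
    have "s ^ d * 1 \<le> \<rho> j ^ d * w v"
      using rad_mono[of 0 j] s w[OF that(1)] by (intro mult_mono power_mono) (auto simp: rad_def)
    also have "\<dots> \<le> measure (torus_space d) (sh j v)"
      unfolding sh_def wnear_def rad_Suc
      by (rule measure_weighted_shell_ge) (use p d x sm w_pos[OF that(1)] rad_pos[of j] in auto)
    finally show ?thesis by simp
  qed
  have one: "measure (var_space d n) (PiE {..<n} (box g)) \<ge> (s ^ d) ^ k / 2" if g: "g \<in> G" for g
  proof -
    have inj: "inj_on g {..<k}" by (rule inj_on_inverseI[of _ "\<lambda>v. v div h"]) (use gdiv[OF g] in auto)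
    have gn: "g ` {..<k} \<subseteq> {..<n}" using ghk[OF g] h by fastforce
    have "(s ^ d) ^ k = (\<Prod>v\<in>g ` {..<k}. s ^ d)" using card_image[OF inj] by simp
    also have "\<dots> = (\<Prod>v\<in>{..<n} \<inter> g ` {..<k}. s ^ d)" using gn by (simp add: Int_absorb1)
    also have "\<dots> = (\<Prod>v<n. if v \<in> g ` {..<k} then s ^ d else 1)"
      by (rule prod.inter_restrict) simp
    finally have c: "(s ^ d) ^ k = (\<Prod>v<n. if v \<in> g ` {..<k} then s ^ d else 1)" .
    have "1 / 2 \<le> (\<Prod>v<n. 1 - ball_vol v)"
    proof -
      have "1 - (\<Sum>v<n. ball_vol v) \<le> (\<Prod>v<n. 1 - ball_vol v)"
        by (rule prod_one_minus_ge) (use ball_vol_nonneg ball_vol_le in \<open>force+\<close>)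
      then show ?thesis using sum_ball_vol_le by linarith
    qed
    \<comment> \<open>The factors \<open>1 - ball_vol v\<close> are kept for the chosen variables
      too; the bound then is one product over all variables.\<close>
    then have "(s ^ d) ^ k * (1 / 2) \<le> (s ^ d) ^ k * (\<Prod>v<n. 1 - ball_vol v)"
      using s by (intro mult_left_mono) auto
    also have "\<dots> = (\<Prod>v<n. (if v \<in> g ` {..<k} then s ^ d else 1) * (1 - ball_vol v))"
      by (simp only: c prod.distrib)
    also have "\<dots> \<le> (\<Prod>v<n. measure (torus_space d) (box g v))"
    proof (rule prod_mono, rule conjI)
      fix v assume v: "v \<in> {..<n}"
      have bv: "0 \<le> ball_vol v" "ball_vol v \<le> 1/2" using ball_vol_nonneg[of v] ball_vol_le[of v] v by auto
      show "0 \<le> (if v \<in> g ` {..<k} then s ^ d else 1) * (1 - ball_vol v)" using bv s by auto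
      show "(if v \<in> g ` {..<k} then s ^ d else 1) * (1 - ball_vol v) \<le> measure (torus_space d) (box g v)"
      proof (cases "v \<in> g ` {..<k}")
        case True
        then obtain j where j: "j < k" "v = g j" by auto
        have "s ^ d * (1 - ball_vol v) \<le> s ^ d * 1" using bv s by (intro mult_left_mono) auto
        also have "\<dots> \<le> measure (torus_space d) (sh j v)" using sh_ge[of v j] v j by simp
        also have "sh j v = box g v" using j ghk[OF g j(1)] gdiv[OF g j(1)] by (simp add: box_def)
        finally show ?thesis using True by simp
      next
        case False
        then have "box g v = out v" using img[OF g, of v] by (auto simp: box_def)
        then show ?thesis using out_ge[of v] v False by simp
      qed
    qed
    also have "\<dots> = measure (var_space d n) (PiE {..<n} (box g))"
      by (rule measure_PiM_PiE[symmetric]) (auto intro: prob_space_torus box_sets)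
    finally show ?thesis by simp
  qed
  have "(real h * s ^ d) ^ k / 2 = (\<Sum>g\<in>G. (s ^ d) ^ k / 2)"
    by (simp add: cardG power_mult_distrib)
  also have "\<dots> \<le> (\<Sum>g\<in>G. measure (var_space d n) (PiE {..<n} (box g)))"
    by (intro sum_mono one)
  also have "\<dots> = measure (var_space d n) (\<Union>g\<in>G. PiE {..<n} (box g))"
    by (rule V.finite_measure_finite_Union[symmetric, OF finG _ disj])
       (auto intro!: sets_PiM_I_finite box_sets)
  also have "\<dots> \<le> measure (var_space d n) {xs \<in> space (var_space d n). lay xs x}"
    by (rule V.finite_measure_mono) (use sub in auto)
  finally show ?thesis .
qed

text \<open>By Tonelli, the expected volume is the average over clause positions \<open>x\<close> of
  the probability that \<open>x\<close> is layered, and almost every \<open>x\<close> lies in the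
  unit cube, where the previous bound applies.\<close>

lemma integral_layered_vol_ge:
  assumes h: "h * k \<le> n"
  shows "integral\<^sup>L (var_space d n) layered_vol \<ge> (real h * s ^ d) ^ k / 2"
proof -
  interpret V: prob_space "var_space d n" by (rule prob_space_vars)
  interpret Q: prob_space "torus_space d" by (rule prob_space_torus)
  interpret pair_sigma_finite "var_space d n" "torus_space d" ..
  let ?S = "{z \<in> space (var_space d n \<Otimes>\<^sub>M torus_space d). lay (fst z) (snd z)}"
  have S: "?S \<in> sets (var_space d n \<Otimes>\<^sub>M torus_space d)" by measurable
  have int: "integrable (var_space d n) layered_vol"
    by (rule V.integrable_const_bound[where B = 1]) (use layered_vol_bounds in auto)
  have "ennreal ((real h * s ^ d) ^ k / 2) = (\<integral>\<^sup>+x. ennreal ((real h * s ^ d) ^ k / 2) \<partial>torus_space d)"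
    by (simp add: Q.emeasure_space_1)
  also have "\<dots> \<le> (\<integral>\<^sup>+x. emeasure (var_space d n) ((\<lambda>xs. (xs, x)) -` ?S) \<partial>torus_space d)"
  proof (rule nn_integral_mono_AE, rule AE_mp[OF AE_inbox], rule AE_I2, rule impI)
    fix x assume x: "x \<in> space (torus_space d)" "inbox d x"
    have "(\<lambda>xs. (xs, x)) -` ?S = {xs \<in> space (var_space d n). lay xs x}"
      using x by (auto simp: space_pair_measure)
    then show "ennreal ((real h * s ^ d) ^ k / 2) \<le> emeasure (var_space d n) ((\<lambda>xs. (xs, x)) -` ?S)"
      using measure_layered_ge[OF x h] by (simp add: V.emeasure_eq_measure ennreal_leI)
  qed
  also have "\<dots> = emeasure (var_space d n \<Otimes>\<^sub>M torus_space d) ?S"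
    by (rule emeasure_pair_measure_alt2[symmetric, OF S])
  also have "\<dots> = (\<integral>\<^sup>+xs. emeasure (torus_space d) (Pair xs -` ?S) \<partial>var_space d n)"
    by (rule Q.emeasure_pair_measure_alt[OF S])
  also have "\<dots> = (\<integral>\<^sup>+xs. ennreal (layered_vol xs) \<partial>var_space d n)"
  proof (rule nn_integral_cong)
    fix xs assume xs: "xs \<in> space (var_space d n)"
    have "Pair xs -` ?S = {x \<in> space (torus_space d). lay xs x}"
      using xs by (auto simp: space_pair_measure)
    then show "emeasure (torus_space d) (Pair xs -` ?S) = ennreal (layered_vol xs)"
      by (simp add: layered_vol_def Q.emeasure_eq_measure)
  qed
  also have "\<dots> = ennreal (integral\<^sup>L (var_space d n) layered_vol)"
    by (rule nn_integral_eq_integral[OF int]) (use layered_vol_bounds in auto)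
  finally show ?thesis
    by (subst (asm) ennreal_le_iff) (use layered_vol_bounds in \<open>auto intro!: Bochner_Integration.integral_nonneg\<close>)
qed

text \<open>The squared influences sum to at most the largest influence times their sum, hence to
  \<open>2 * \<beta>\<close>. Bounded differences with deviation \<open>\<eta> / 2\<close> then give
  the tail.\<close>

lemma layered_vol_concentration:
  assumes h: "h * k \<le> n" and \<beta>: "\<And>v. v < n \<Longrightarrow> ball_vol v \<le> \<beta>" "\<beta> > 0"
    and \<eta>: "\<eta> > 0" "\<eta> \<le> (real h * s ^ d) ^ k / 2"
  shows "measure (var_space d n) {xs \<in> space (var_space d n). layered_vol xs \<le> \<eta> / 2} \<le> exp (- \<eta>\<^sup>2 / (16 * \<beta>))"
proof -
  interpret V: prob_space "var_space d n" by (rule prob_space_vars)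
  have "(\<Sum>v<n. (2 * ball_vol v)\<^sup>2) \<le> (\<Sum>v<n. 4 * \<beta> * ball_vol v)"
  proof (rule sum_mono)
    fix v assume "v \<in> {..<n}"
    then have "ball_vol v * ball_vol v \<le> \<beta> * ball_vol v" using \<beta>(1) ball_vol_nonneg by (intro mult_right_mono) auto
    then show "(2 * ball_vol v)\<^sup>2 \<le> 4 * \<beta> * ball_vol v" by (simp add: power2_eq_square)
  qed
  also have "\<dots> = 4 * \<beta> * (\<Sum>v<n. ball_vol v)" by (simp add: sum_distrib_left)
  also have "\<dots> \<le> 4 * \<beta> * (1 / 2)" using \<beta> sum_ball_vol_le by (intro mult_left_mono) auto
  finally have S: "(\<Sum>v<n. (2 * ball_vol v)\<^sup>2) \<le> 2 * \<beta>" by simp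
  have "measure (var_space d n) {xs \<in> space (var_space d n). layered_vol xs \<le> \<eta> / 2}
      \<le> measure (var_space d n) {xs \<in> space (var_space d n). layered_vol xs \<le> integral\<^sup>L (var_space d n) layered_vol - \<eta> / 2}"
    by (rule V.finite_measure_mono) (use integral_layered_vol_ge[OF h] \<eta> in auto)
  also have "\<dots> \<le> exp (- (\<eta> / 2)\<^sup>2 / (2 * (2 * \<beta>)))"
    by (rule bounded_differences_lower_tail[where c = "\<lambda>v. 2 * ball_vol v" and B = 1])
       (use prob_space_torus \<eta>(1) layered_vol_bounds layered_vol_bounded_diff S \<beta> in auto)
  also have "\<dots> = exp (- \<eta>\<^sup>2 / (16 * \<beta>))" by (simp add: power_divide)
  finally show ?thesis .
qed

section \<open>Nice clauses\<close>

definition tail_sum :: "(nat \<Rightarrow> nat \<Rightarrow> real) \<Rightarrow> (nat \<Rightarrow> real) \<Rightarrow> real" where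
  "tail_sum xs x = (\<Sum>v<n. tail_weight T d p (\<rho> k) (w v) x (xs v))"

lemma tail_sum_measurable [measurable (raw)]:
  assumes f: "f \<in> measurable N (var_space d n)" and g: "g \<in> measurable N (torus_space d)"
  shows "(\<lambda>z. tail_sum (f z) (g z)) \<in> borel_measurable N"
  unfolding tail_sum_def
  by (rule borel_measurable_sum) (auto intro!: tail_weight_measurable g vars_component_measurable[OF _ f])

text \<open>\<open>4 ^ d\<close> times the value of the dyadic geometric series. It depends on
  \<open>d\<close> and \<open>T\<close> only, so it stays constant as \<open>n\<close>
  grows.\<close>

definition tail_const :: real where
  "tail_const = 4 ^ d / (1 - 2 powr (real d - real d / T))"

lemma tail_const_pos: "tail_const > 0"
proof -
  have "real d - real d / T < 0" using d T by (simp add: field_simps)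
  then have "2 powr (real d - real d / T) < 2 powr 0" by (intro powr_less_mono) auto
  then show ?thesis by (simp add: tail_const_def)
qed

text \<open>Markov's inequality. Summing the integral bounds over the variables leaves the factor
  \<open>\<rho> k ^ d\<close> times the total weight, which is at most 1 by
  \<open>small\<close>.\<close>

lemma measure_tail_sum_large_le:
  assumes xs: "xs \<in> space (var_space d n)" and K: "K > 0"
  shows "measure (torus_space d) {x \<in> space (torus_space d). tail_sum xs x > K * \<rho> k powr (- real d / T)}
           \<le> tail_const / K"
proof -
  interpret prob_space "torus_space d" by (rule prob_space_torus)
  note [measurable] = xs
  have C: "tail_const > 0" by (rule tail_const_pos)
  let ?R = "\<rho> k powr (- real d / T)"
  have R: "?R > 0" using rad_pos[of k] by simp
  have tw: "0 \<le> tail_weight T d p (\<rho> k) (w v) x y" for v x y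
    by (simp add: tail_weight_def conn_weight_def)
  have "(\<integral>\<^sup>+x. ennreal (tail_sum xs x) \<partial>torus_space d)
      = (\<integral>\<^sup>+x. (\<Sum>v<n. ennreal (tail_weight T d p (\<rho> k) (w v) x (xs v))) \<partial>torus_space d)"
    unfolding tail_sum_def by (subst sum_ennreal) (auto simp: tw)
  also have "\<dots> = (\<Sum>v<n. \<integral>\<^sup>+x. ennreal (tail_weight T d p (\<rho> k) (w v) x (xs v)) \<partial>torus_space d)"
    by (rule nn_integral_sum)
       (auto intro!: measurable_compose[OF _ measurable_ennreal] tail_weight_measurable measurable_const
          space_vars_component[OF xs])
  also have "\<dots> \<le> (\<Sum>v<n. ennreal (tail_const * (\<rho> k ^ d * w v) * ?R))"
    unfolding tail_const_def
    by (intro sum_mono nn_integral_tail_weight_le) (use p d T rad_pos w_pos space_vars_component[OF xs] in auto)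
  also have "\<dots> = ennreal (\<Sum>v<n. tail_const * (\<rho> k ^ d * w v) * ?R)"
    by (rule sum_ennreal) (use C R rad_pos[of k] w_pos in \<open>auto intro!: mult_nonneg_nonneg less_imp_le\<close>)
  also have "(\<Sum>v<n. tail_const * (\<rho> k ^ d * w v) * ?R) = tail_const * ?R * (\<rho> k ^ d * (\<Sum>v<n. w v))"
    by (simp add: sum_distrib_left sum_distrib_right mult_ac)
  also have "\<dots> \<le> tail_const * ?R * 1"
  proof (intro mult_left_mono)
    have "\<rho> k ^ d * (\<Sum>v<n. w v) \<le> (2 * \<rho> k) ^ d * (\<Sum>v<n. w v)"
      using rad_pos[of k] w_pos by (intro mult_right_mono power_mono sum_nonneg) (auto intro: less_imp_le)
    then show "\<rho> k ^ d * (\<Sum>v<n. w v) \<le> 1" using small by linarith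
  qed (use C R in auto)
  finally have int: "(\<integral>\<^sup>+x. ennreal (tail_sum xs x) \<partial>torus_space d) \<le> ennreal (tail_const * ?R)"
    by (simp add: ennreal_leI)
  have "emeasure (torus_space d) {x \<in> space (torus_space d). tail_sum xs x > K * ?R}
     \<le> emeasure (torus_space d) {x \<in> space (torus_space d). 1 \<le> ennreal (1 / (K * ?R)) * ennreal (tail_sum xs x)}"
  proof (rule emeasure_mono)
    show "{x \<in> space (torus_space d). tail_sum xs x > K * ?R} \<subseteq>
       {x \<in> space (torus_space d). 1 \<le> ennreal (1 / (K * ?R)) * ennreal (tail_sum xs x)}"
    proof safe
      fix x assume "tail_sum xs x > K * ?R"
      then have "1 \<le> 1 / (K * ?R) * tail_sum xs x" using K R by (simp add: field_simps)
      then have "ennreal 1 \<le> ennreal (1 / (K * ?R) * tail_sum xs x)" by (rule ennreal_leI)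
      moreover have "0 \<le> 1 / (K * ?R)" using K R by simp
      ultimately show "1 \<le> ennreal (1 / (K * ?R)) * ennreal (tail_sum xs x)"
        by (simp only: ennreal_mult' ennreal_1)
    qed
  qed measurable
  also have "\<dots> \<le> ennreal (1 / (K * ?R)) * (\<integral>\<^sup>+x. ennreal (tail_sum xs x) * indicator (space (torus_space d)) x \<partial>torus_space d)"
    by (rule nn_integral_Markov_inequality) measurable
  also have "\<dots> = ennreal (1 / (K * ?R)) * (\<integral>\<^sup>+x. ennreal (tail_sum xs x) \<partial>torus_space d)"
    by (intro arg_cong2[where f = "(*)"] nn_integral_cong) auto
  also have "\<dots> \<le> ennreal (1 / (K * ?R)) * ennreal (tail_const * ?R)"
    by (intro mult_left_mono int) auto
  also have "\<dots> = ennreal (tail_const / K)"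
    using K R C by (simp flip: ennreal_mult)
  finally show ?thesis
    using C K by (simp add: emeasure_eq_measure)
qed

text \<open>The threshold is \<open>K\<close> times the connection weight at the largest radius, and
  each of the \<open>k\<close> chosen variables has at least this weight.\<close>

definition good :: "real \<Rightarrow> (nat \<Rightarrow> nat \<Rightarrow> real) \<Rightarrow> (nat \<Rightarrow> real) \<Rightarrow> bool" where
  "good K xs x \<longleftrightarrow> inbox d x \<and> lay xs x \<and> tail_sum xs x \<le> K * \<rho> k powr (- real d / T)"

lemma good_measurable [measurable (raw)]:
  assumes [measurable]: "f \<in> measurable N (var_space d n)" "g \<in> measurable N (torus_space d)"
  shows "Measurable.pred N (\<lambda>z. good K (f z) (g z))"
  unfolding good_def by measurable

lemma measure_good_ge:
  assumes xs: "xs \<in> space (var_space d n)" and K: "K > 0"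
  shows "measure (torus_space d) {x \<in> space (torus_space d). good K xs x} \<ge> layered_vol xs - tail_const / K"
proof -
  interpret prob_space "torus_space d" by (rule prob_space_torus)
  note [measurable] = xs
  let ?B = "{x \<in> space (torus_space d). tail_sum xs x > K * \<rho> k powr (- real d / T)}"
  let ?G = "{x \<in> space (torus_space d). good K xs x}"
  have "layered_vol xs \<le> measure (torus_space d) (?G \<union> ?B)"
    unfolding layered_vol_def
  proof (rule finite_measure_mono_AE)
    show "AE x in torus_space d. x \<in> {x \<in> space (torus_space d). lay xs x} \<longrightarrow> x \<in> ?G \<union> ?B"
      using AE_inbox by eventually_elim (auto simp: good_def)
  qed measurable
  also have "\<dots> \<le> measure (torus_space d) ?G + measure (torus_space d) ?B"
    by (rule measure_Un_le) measurable
  finally show ?thesis using measure_tail_sum_large_le[OF xs K] by linarith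
qed

text \<open>Drawing the shell variables from the inside out is a nice outcome. Before each draw the
  remaining weight is at most \<open>k + K\<close> times the weight to be drawn: at most
  \<open>k\<close> shell variables of no larger weight, and a tail of at most \<open>K\<close> times
  that weight.\<close>

lemma nice_prob_ge:
  assumes good: "good K xs x" and ib: "\<And>v. v < n \<Longrightarrow> inbox d (xs v)" and K: "K > 0"
    and X: "X = (\<lambda>v. conn_weight T d p (w v) x (xs v))"
  shows "measure_pmf.prob (draw_seq X {..<n} k) {vs. nice_clause n X vs} \<ge> (1 / (real k + K)) ^ k"
proof -
  let ?D = "\<lambda>v. torus_dist p d x (xs v)"
  let ?z = "\<lambda>r. r powr (- real d / T)"
  have xb: "inbox d x" and "lay xs x" and tail: "tail_sum xs x \<le> K * ?z (\<rho> k)"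
    using good by (auto simp: good_def)
  then obtain u where u: "u \<in> {..<k} \<rightarrow>\<^sub>E {..<n}"
     "\<And>j. j < k \<Longrightarrow> near_var (\<rho> (Suc j)) x (u j) (xs (u j))"
     "\<And>j. j < k \<Longrightarrow> \<not> near_var (\<rho> j) x (u j) (xs (u j))"
     "\<And>v. v < n \<Longrightarrow> v \<notin> u ` {..<k} \<Longrightarrow> \<not> near_var (\<rho> k) x v (xs v)"
    unfolding layered_def by blast
  have un: "u j < n" if "j < k" for j using u(1) that by (auto simp: PiE_iff)
  have nv: "near_var r x v (xs v) \<longleftrightarrow> ?D v \<le> r * w v powr (1 / real d)" if "v < n" for r v
    using xb ib[OF that] by (simp add: wnear_def near_def)
  have far: "?D v > 0 \<and> X v < ?z r" if "v < n" "\<not> near_var r x v (xs v)" "r > 0" for v r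
  proof -
    have D: "?D v > r * w v powr (1 / real d)" using nv that by auto
    moreover have "r * w v powr (1 / real d) > 0" using that(3) w_pos[OF that(1)] by simp
    ultimately have "?D v > 0" by linarith
    then show ?thesis unfolding X using conn_weight_less[OF D] that w_pos d T by auto
  qed
  \<comment> \<open>Every variable is outside some ball of positive radius, so no distance vanishes
    and no weight degenerates to 0.\<close>
  have Dpos: "?D v > 0" if "v < n" for v
    using far[OF that] u(3,4) that rad_pos by (cases "v \<in> u ` {..<k}") auto
  have Xpos: "X v > 0" if "v < n" for v
    unfolding X conn_weight_def using Dpos[OF that] w_pos[OF that] by simp
  have zmono: "?z (\<rho> j) \<le> ?z (\<rho> i)" if "i \<le> j" for i j
    using rad_mono[OF that] rad_pos T by (intro powr_mono2') auto
  have lo: "X (u j) \<ge> ?z (\<rho> (Suc j))" if "j < k" for j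
    unfolding X using u(2)[OF that] nv[OF un[OF that]] Dpos[OF un[OF that]] w_pos[OF un[OF that]] d T
    by (intro conn_weight_ge) auto
  have hi: "X (u j) < ?z (\<rho> j)" if "j < k" for j
    using far[OF un[OF that] u(3)[OF that] rad_pos] by simp
  \<comment> \<open>The weight in an outer shell is below the value at its inner radius, which is at
    most the value at the outer radius of any earlier shell.\<close>
  have ord: "X (u j) < X (u i)" if "i < j" "j < k" for i j
    using hi[OF that(2)] zmono[of "Suc i" j] lo[of i] that by force
  have inj: "inj_on u {..<k}"
  proof (rule inj_onI)
    fix i j assume "i \<in> {..<k}" "j \<in> {..<k}" "u i = u j"
    then show "i = j" using ord[of i j] ord[of j i] by (cases i j rule: linorder_cases) auto
  qed
  define vs where "vs = map u [0..<k]"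
  have len: "length vs = k" by (simp add: vs_def)
  have nth: "vs ! j = u j" if "j < k" for j using that by (simp add: vs_def)
  have tk: "set (take j vs) = u ` {..<j}" if "j \<le> k" for j
    using that by (simp add: vs_def take_map atLeast0LessThan)
  have nice: "nice_clause n X vs"
    unfolding nice_clause_def len
  proof (intro allI impI)
    fix j v assume j: "j < k" and v: "v < n" "v \<notin> set (take (Suc j) vs)"
    have v': "v \<notin> u ` {..<Suc j}" using v(2) j by (subst (asm) tk) auto
    show "X v < X (vs ! j)"
    proof (cases "v \<in> u ` {..<k}")
      case True
      then obtain i where i: "i < k" "v = u i" by auto
      have "j < i" using v' i by (cases "i < Suc j") auto
      then show ?thesis using ord[of j i] i j by (simp add: nth)
    next
      case False
      have "X v < ?z (\<rho> k)" using far[OF v(1) u(4)[OF v(1) False] rad_pos] by simp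
      also have "\<dots> \<le> ?z (\<rho> (Suc j))" using j by (intro zmono) auto
      also have "\<dots> \<le> X (u j)" by (rule lo[OF j])
      finally show ?thesis using j by (simp add: nth)
    qed
  qed
  have "(1 / (real k + K)) ^ length vs \<le> pmf (draw_seq X {..<n} (length vs)) vs"
  proof (rule draw_seq_lower_bound)
    fix j assume "j < length vs"
    then have j: "j < k" by (simp add: len)
    let ?S = "{..<n} - set (take j vs)"
    have S: "?S = {..<n} - u ` {..<j}" using j by (subst tk) auto
    have tw0: "0 \<le> tail_weight T d p (\<rho> k) (w v) x (xs v)" for v
      by (simp add: tail_weight_def conn_weight_def)
    have Xj: "0 \<le> X (u j)" using Xpos[OF un[OF j]] by simp
    have "(\<Sum>v\<in>?S. X v) \<le> (\<Sum>v\<in>?S. (if v \<in> u ` {..<k} then X (u j) else 0) + tail_weight T d p (\<rho> k) (w v) x (xs v))"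
    proof (rule sum_mono)
      fix v assume "v \<in> ?S"
      then have v: "v < n" "v \<notin> u ` {..<j}" unfolding S by auto
      show "X v \<le> (if v \<in> u ` {..<k} then X (u j) else 0) + tail_weight T d p (\<rho> k) (w v) x (xs v)"
      proof (cases "v \<in> u ` {..<k}")
        case True
        then obtain i where i: "i < k" "v = u i" by auto
        have "j \<le> i" using v i by (cases "i < j") auto
        then have "X v \<le> X (u j)" using ord[of j i] i by (cases "i = j") auto
        then show ?thesis using True tw0[of v] by simp
      next
        case False
        have "tail_weight T d p (\<rho> k) (w v) x (xs v) = X v"
          using u(4)[OF v(1) False] xb ib[OF v(1)] by (simp add: tail_weight_def X wnear_def)
        then show ?thesis using False by simp
      qed
    qed
    also have "\<dots> = (\<Sum>v\<in>?S. (if v \<in> u ` {..<k} then X (u j) else 0)) + (\<Sum>v\<in>?S. tail_weight T d p (\<rho> k) (w v) x (xs v))"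
      by (rule sum.distrib)
    also have "\<dots> \<le> real k * X (u j) + K * X (u j)"
    proof (rule add_mono)
      have "(\<Sum>v\<in>?S. (if v \<in> u ` {..<k} then X (u j) else 0)) = real (card (?S \<inter> u ` {..<k})) * X (u j)"
        by (subst sum.inter_restrict[symmetric]) auto
      also have "card (?S \<inter> u ` {..<k}) \<le> card (u ` {..<k})" by (rule card_mono) auto
      then have "real (card (?S \<inter> u ` {..<k})) * X (u j) \<le> real k * X (u j)"
        using card_image[OF inj] Xj by (intro mult_right_mono) auto
      finally show "(\<Sum>v\<in>?S. (if v \<in> u ` {..<k} then X (u j) else 0)) \<le> real k * X (u j)" .
      have "(\<Sum>v\<in>?S. tail_weight T d p (\<rho> k) (w v) x (xs v)) \<le> tail_sum xs x"
        unfolding tail_sum_def by (rule sum_mono2) (auto simp: tw0)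
      also have "\<dots> \<le> K * ?z (\<rho> k)" by (rule tail)
      also have "\<dots> \<le> K * X (u j)"
        using K lo[OF j] zmono[of "Suc j" k] j by (intro mult_left_mono) auto
      finally show "(\<Sum>v\<in>?S. tail_weight T d p (\<rho> k) (w v) x (xs v)) \<le> K * X (u j)" .
    qed
    finally show "(\<Sum>v\<in>?S. X v) \<le> (real k + K) * X (vs ! j)" using j by (simp add: nth algebra_simps)
  qed (use Xpos un inj K in \<open>auto simp: vs_def distinct_map atLeast0LessThan\<close>)
  also have "\<dots> \<le> measure_pmf.prob (draw_seq X {..<n} k) {vs. nice_clause n X vs}"
    unfolding len pmf.rep_eq using nice by (intro measure_pmf.finite_measure_mono) auto
  finally show ?thesis by (simp add: len)
qed

text \<open>The three exponentials bound three failures: too small a layered volume, too few clauses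
  in good position, and too few nice draws among those. In \<open>q * r / 4\<close> each of the two
  counting steps loses a factor of 2; the upper bound \<open>m\<close> on the count is
  trivial.\<close>

lemma prob_num_nice_ge:
  assumes h: "h * k \<le> n" and \<beta>: "\<And>v. v < n \<Longrightarrow> ball_vol v \<le> \<beta>" "\<beta> > 0"
    and \<eta>: "\<eta> > 0" "\<eta> \<le> (real h * s ^ d) ^ k / 2"
    and K: "K > 0" "tail_const / K \<le> \<eta> / 4" and m: "m > 0"
    and q: "q = \<eta> / 4" and r: "r = (1 / (real k + K)) ^ k"
  shows "prob_num_nice T d p k w n m (\<lambda>N. q * r / 4 * real m \<le> real N \<and> real N \<le> 1 * real m)
     \<ge> ennreal (1 - (exp (- \<eta>\<^sup>2 / (16 * \<beta>)) + exp (- real m * q\<^sup>2 / 8) + exp (- real m * q * r\<^sup>2 / 4)))"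
proof -
  let ?V = "var_space d n" and ?C = "var_space d m"
  interpret V: prob_space ?V by (rule prob_space_vars)
  interpret C: prob_space ?C by (rule prob_space_vars)
  interpret Q: prob_space "torus_space d" by (rule prob_space_torus)
  define e0 e1 e2 where "e0 = exp (- \<eta>\<^sup>2 / (16 * \<beta>))" and "e1 = exp (- real m * q\<^sup>2 / 8)"
    and "e2 = exp (- real m * q * r\<^sup>2 / 4)"
  have q0: "q > 0" using q \<eta> by simp
  have r0: "r > 0" using r K by simp
  have e: "0 \<le> e0" "e0 \<le> 1" "0 \<le> e1" "e1 \<le> 1" "0 \<le> e2" "e2 \<le> 1"
    using q0 \<beta>(2) by (auto simp: e0_def e1_def e2_def)
  define V0 where "V0 = {xs \<in> space ?V. layered_vol xs > \<eta> / 2 \<and> (\<forall>v<n. inbox d (xs v))}"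
  have ibm: "Measurable.pred ?V (\<lambda>xs. \<forall>v<n. inbox d (xs v))"
    by (intro pred_intros_countable pred_intros_imp' inbox_measurable vars_component_measurable) auto
  have V0 [measurable]: "V0 \<in> sets ?V"
    unfolding V0_def using ibm by measurable
  have "AE xs in ?V. \<forall>v\<in>{..<n}. inbox d (xs v)"
    by (intro AE_finite_allI AE_PiM_component) (auto intro: prob_space_torus AE_inbox)
  then have AEib: "AE xs in ?V. \<forall>v<n. inbox d (xs v)" by auto
  have V0_ge: "measure ?V V0 \<ge> 1 - e0"
  proof -
    have "1 - e0 \<le> 1 - measure ?V {xs \<in> space ?V. layered_vol xs \<le> \<eta> / 2}"
      using layered_vol_concentration[OF h \<beta> \<eta>] by (simp add: e0_def)
    also have "\<dots> = measure ?V (space ?V - {xs \<in> space ?V. layered_vol xs \<le> \<eta> / 2})"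
      by (rule V.prob_compl[symmetric]) measurable
    also have "\<dots> \<le> measure ?V V0"
    proof (rule V.finite_measure_mono_AE)
      show "AE xs in ?V. xs \<in> space ?V - {xs \<in> space ?V. layered_vol xs \<le> \<eta> / 2} \<longrightarrow> xs \<in> V0"
        using AEib by eventually_elim (auto simp: V0_def)
    qed (rule V0)
    finally show ?thesis .
  qed
  \<comment> \<open>Written as a sum over the clauses to obtain joint measurability in both families
    of positions.\<close>
  define cnt where "cnt = (\<lambda>z. \<Sum>c<m. if good K (fst z) (snd z c) then 1 else 0 :: real)"
  have cnt_eq: "cnt (xs, cs) = real (card {c \<in> {..<m}. good K xs (cs c)})" for xs cs
    by (simp add: cnt_def sum.If_cases Int_def)
  have cnt_m: "cnt \<in> borel_measurable (?V \<Otimes>\<^sub>M ?C)"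
    unfolding cnt_def
  proof (rule borel_measurable_sum)
    fix c assume c: "c \<in> {..<m}"
    have [measurable]: "(\<lambda>z. snd z c) \<in> measurable (?V \<Otimes>\<^sub>M ?C) (torus_space d)"
      by (rule vars_component_measurable[of c m]) (use c in auto)
    show "(\<lambda>z. if good K (fst z) (snd z c) then 1 else 0 :: real) \<in> borel_measurable (?V \<Otimes>\<^sub>M ?C)"
      by measurable
  qed
  define S where "S = {z \<in> space (?V \<Otimes>\<^sub>M ?C). fst z \<in> V0 \<and> cnt z \<ge> q * real m / 2}"
  have S: "S \<in> sets (?V \<Otimes>\<^sub>M ?C)"
    unfolding S_def using cnt_m by measurable
  have slice: "measure ?C (Pair xs -` S) \<ge> 1 - e1" if xs: "xs \<in> V0" for xs
  proof -
    have xs': "xs \<in> space ?V" and Fxs: "layered_vol xs > \<eta> / 2" using xs by (auto simp: V0_def)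
    let ?G = "{x \<in> space (torus_space d). good K xs x}"
    have G: "?G \<in> sets (torus_space d)" using xs' by measurable
    \<comment> \<open>A layered volume above \<open>\<eta> / 2\<close>, reduced by at most
      \<open>\<eta> / 4\<close> for large tails, leaves \<open>q = \<eta> / 4\<close>.\<close>
    have "q \<le> measure (torus_space d) ?G"
      using measure_good_ge[OF xs' K(1)] K(2) Fxs q by linarith
    from count_lower_tail[OF prob_space_torus G this q0 m]
    have "1 - e1 \<le> measure ?C {y \<in> space ?C. real (card {c \<in> {..<m}. y c \<in> ?G}) \<ge> q * real m / 2}"
      by (simp add: e1_def)
    also have "{y \<in> space ?C. real (card {c \<in> {..<m}. y c \<in> ?G}) \<ge> q * real m / 2} = Pair xs -` S"
    proof -
      have "{c \<in> {..<m}. y c \<in> ?G} = {c \<in> {..<m}. good K xs (y c)}" if "y \<in> space ?C" for y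
        using that by (auto simp: space_PiM PiE_iff)
      then show ?thesis
        using xs xs' by (auto simp: S_def cnt_eq space_pair_measure simp del: mem_Collect_eq)
    qed
    finally show ?thesis .
  qed
  have "ennreal ((1 - e1) * (1 - e0)) \<le> ennreal (1 - e1) * emeasure ?V V0"
    using e V0_ge by (simp add: V.emeasure_eq_measure ennreal_leI mult_left_mono flip: ennreal_mult)
  also have "\<dots> = (\<integral>\<^sup>+xs. ennreal (1 - e1) * indicator V0 xs \<partial>?V)"
    by (rule nn_integral_cmult_indicator[symmetric, OF V0])
  also have "\<dots> \<le> (\<integral>\<^sup>+xs. emeasure ?C (Pair xs -` S) \<partial>?V)"
    by (intro nn_integral_mono)
       (use slice in \<open>auto simp: indicator_def C.emeasure_eq_measure ennreal_leI\<close>)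
  also have "\<dots> = emeasure (?V \<Otimes>\<^sub>M ?C) S"
    by (rule C.emeasure_pair_measure_alt[symmetric, OF S])
  finally have S_ge: "ennreal ((1 - e1) * (1 - e0)) \<le> emeasure (?V \<Otimes>\<^sub>M ?C) S" .
  let ?P = "\<lambda>N::nat. q * r / 4 * real m \<le> real N \<and> real N \<le> 1 * real m"
  have pt: "measure_pmf.prob (clause_draws T d p k w n m xs cs) {D. ?P (num_nice T d p w n m xs cs D)} \<ge> 1 - e2"
    if z: "(xs, cs) \<in> S" for xs cs
  proof -
    let ?X = "\<lambda>c v. conn_weight T d p (w v) (cs c) (xs v)"
    let ?G = "{c \<in> {..<m}. good K xs (cs c)}"
    let ?N = "\<lambda>c. {vs. nice_clause n (?X c) vs}"
    have ib: "inbox d (xs v)" if "v < n" for v using z that by (auto simp: S_def V0_def)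
    have cG: "real (card ?G) \<ge> q * real m / 2" using z by (auto simp: S_def cnt_eq)
    have "1 - e2 \<le> 1 - exp (- real (card ?G) * r\<^sup>2 / 2)"
    proof -
      have "q * real m / 2 * r\<^sup>2 \<le> real (card ?G) * r\<^sup>2" using cG by (intro mult_right_mono) auto
      then show ?thesis by (simp add: e2_def mult_ac)
    qed
    also have "\<dots> \<le> measure_pmf.prob (clause_draws T d p k w n m xs cs)
        {D. real (card {c \<in> {..<m}. D c \<in> ?N c}) \<ge> real (card ?G) * r / 2}"
      unfolding clause_draws_def
      by (rule Pi_pmf_count_lower_tail) (use r0 nice_prob_ge[OF _ ib K(1) refl] in \<open>auto simp: r\<close>)
    also have "\<dots> \<le> measure_pmf.prob (clause_draws T d p k w n m xs cs) {D. ?P (num_nice T d p w n m xs cs D)}"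
    proof (rule measure_pmf.finite_measure_mono)
      have le: "q * r / 4 * real m \<le> real (card ?G) * r / 2"
        using mult_right_mono[OF cG, of r] r0 by (simp add: field_simps)
      have "card {c \<in> {..<m}. A c} \<le> m" for A
        using card_mono[of "{..<m}" "{c \<in> {..<m}. A c}"] by auto
      then show "{D. real (card {c \<in> {..<m}. D c \<in> ?N c}) \<ge> real (card ?G) * r / 2}
          \<subseteq> {D. ?P (num_nice T d p w n m xs cs D)}"
        using le by (auto simp: num_nice_def)
    qed simp
    finally show ?thesis .
  qed
  have "1 - (e0 + e1 + e2) \<le> (1 - e2) * ((1 - e1) * (1 - e0))"
  proof -
    have a: "1 - (e0 + e1) \<le> (1 - e1) * (1 - e0)" using e by (simp add: algebra_simps)
    have "(1 - e1) * (1 - e0) \<le> 1 * 1" using e by (intro mult_mono) auto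
    then have "e2 * ((1 - e1) * (1 - e0)) \<le> e2 * 1" using e by (intro mult_left_mono) auto
    then show ?thesis using a by (simp add: left_diff_distrib)
  qed
  then have "ennreal (1 - (e0 + e1 + e2)) \<le> ennreal ((1 - e2) * ((1 - e1) * (1 - e0)))" by (rule ennreal_leI)
  also have "\<dots> = ennreal (1 - e2) * ennreal ((1 - e1) * (1 - e0))"
    using e by (intro ennreal_mult) auto
  also have "\<dots> \<le> ennreal (1 - e2) * emeasure (?V \<Otimes>\<^sub>M ?C) S"
    by (intro mult_left_mono S_ge) auto
  also have "\<dots> = (\<integral>\<^sup>+z. ennreal (1 - e2) * indicator S z \<partial>(?V \<Otimes>\<^sub>M ?C))"
    by (rule nn_integral_cmult_indicator[symmetric, OF S])
  also have "\<dots> \<le> prob_num_nice T d p k w n m ?P"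
    unfolding prob_num_nice_def positions_space_def
  proof (rule nn_integral_mono)
    fix z :: "(nat \<Rightarrow> nat \<Rightarrow> real) \<times> (nat \<Rightarrow> nat \<Rightarrow> real)"
    show "ennreal (1 - e2) * indicator S z \<le> emeasure (measure_pmf (clause_draws T d p k w n m (fst z) (snd z)))
                 {D. ?P (num_nice T d p w n m (fst z) (snd z) D)}"
      using pt[of "fst z" "snd z"]
      by (cases "z \<in> S") (auto simp: measure_pmf.emeasure_eq_measure ennreal_leI)
  qed
  finally show ?thesis by (simp add: e0_def e1_def e2_def)
qed

end

section \<open>Asymptotics\<close>

lemma eventually_exp_powr_le:
  fixes a \<epsilon> :: real
  assumes "a > 0" "\<epsilon> > 0"
  shows "eventually (\<lambda>n. exp (- a * real n powr \<epsilon>) \<le> 1 / real n) at_top"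
  using assms by real_asymp

lemma eventually_exp_linear_le:
  fixes a :: real
  assumes "a > 0"
  shows "eventually (\<lambda>n. exp (- a * real n) \<le> 1 / real n) at_top"
  using assms by real_asymp

theorem mainTheorem11:
  fixes d k :: nat and p :: enat and T \<epsilon> :: real
    and w :: "nat \<Rightarrow> nat \<Rightarrow> real"  \<comment> \<open>w n v: weight of variable v in the instance with n variables\<close>
    and m :: "nat \<Rightarrow> nat"           \<comment> \<open>m n: number of clauses\<close>
  assumes d_pos: "d \<ge> 1"
    and p_pos: "p \<ge> 1"
    and T: "0 < T" "T < 1"
    and eps: "\<epsilon> > 0"
    and w_ge1: "\<And>n v. v < n \<Longrightarrow> w n v \<ge> 1"
    and w_min: "\<And>n. n \<ge> 1 \<Longrightarrow> (\<exists>v<n. w n v = 1)"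
    and m_lin: "(\<lambda>n. real (m n)) \<in> \<Theta>(\<lambda>n. real n)"
    and W_lin: "(\<lambda>n. \<Sum>v<n. w n v) \<in> O(\<lambda>n. real n)"
    and w_max: "\<exists>C. eventually (\<lambda>n. \<forall>v<n. w n v \<le> C * real n powr (1 - \<epsilon>)) at_top"
  shows "\<exists>c1 c2 C. c1 > 0 \<and> c2 > 0 \<and>
           eventually (\<lambda>n. prob_num_nice T d p k (w n) n (m n)
                (\<lambda>N. c1 * real (m n) \<le> real N \<and> real N \<le> c2 * real (m n))
              \<ge> ennreal (1 - C / real n)) at_top"
proof -
  obtain CW where CW: "CW > 0" "eventually (\<lambda>n. norm (\<Sum>v<n. w n v) \<le> CW * norm (real n)) at_top"
    using W_lin by (rule landau_o.bigE)
  have "(\<lambda>n. real (m n)) \<in> \<Omega>(\<lambda>n. real n)" using m_lin by (rule bigthetaD2)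
  then obtain cm where cm: "cm > 0" "eventually (\<lambda>n. norm (real (m n)) \<ge> cm * norm (real n)) at_top"
    by (rule landau_omega.bigE)
  obtain C0 where C0: "eventually (\<lambda>n. \<forall>v<n. w n v \<le> C0 * real n powr (1 - \<epsilon>)) at_top"
    using w_max by blast
  define Cw where "Cw = max C0 1"
  define A where "A = 2 ^ d * ((4 * real d) ^ k) ^ d"
  \<comment> \<open>Chosen so that \<open>A * \<delta> * CW = 1/2\<close>. With
    \<open>s n ^ d = \<delta> / n\<close> this is the hypothesis \<open>small\<close> of the
    locale.\<close>
  define \<delta> where "\<delta> = 1 / (2 * A * CW)"
  define s where "s = (\<lambda>n. (\<delta> / real n) powr (1 / real d))"
  define \<eta> where "\<eta> = (\<delta> / (2 * real (Suc k))) ^ k / 2"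
  \<comment> \<open>\<open>K\<close> is four times the tail constant over \<open>\<eta>\<close>, so
    Markov's bound equals \<open>\<eta> / 4\<close>.\<close>
  define K where "K = 4 * (4 ^ d / (1 - 2 powr (real d - real d / T))) / \<eta>"
  define q where "q = \<eta> / 4"
  define r where "r = (1 / (real k + K)) ^ k"
  define B where "B = A * \<delta> * Cw"
  have A: "A > 0" using d_pos by (simp add: A_def)
  have \<delta>: "\<delta> > 0" using A CW by (simp add: \<delta>_def)
  have Cw: "Cw > 0" by (simp add: Cw_def)
  have B: "B > 0" using A \<delta> Cw by (simp add: B_def)
  have \<eta>: "\<eta> > 0" using \<delta> by (simp add: \<eta>_def)
  have Kpos: "K > 0"
  proof -
    have "real d - real d / T < 0" using d_pos T by (simp add: field_simps)
    then have "2 powr (real d - real d / T) < 2 powr 0" by (intro powr_less_mono) auto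
    then show ?thesis using \<eta> by (simp add: K_def)
  qed
  have q: "q > 0" using \<eta> by (simp add: q_def)
  have r: "r > 0" using Kpos by (simp add: r_def)
  have e0: "eventually (\<lambda>n. exp (- (\<eta>\<^sup>2 / (16 * B)) * real n powr \<epsilon>) \<le> 1 / real n) at_top"
    by (rule eventually_exp_powr_le) (use \<eta> B eps in auto)
  have e1: "eventually (\<lambda>n. exp (- (cm * q\<^sup>2 / 8) * real n) \<le> 1 / real n) at_top"
    by (rule eventually_exp_linear_le) (use q cm in auto)
  have e2: "eventually (\<lambda>n. exp (- (cm * q * r\<^sup>2 / 4) * real n) \<le> 1 / real n) at_top"
    by (rule eventually_exp_linear_le) (use q r cm in auto)
  have "eventually (\<lambda>n. prob_num_nice T d p k (w n) n (m n)
                (\<lambda>N. q * r / 4 * real (m n) \<le> real N \<and> real N \<le> 1 * real (m n))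
              \<ge> ennreal (1 - 3 / real n)) at_top"
    using CW(2) cm(2) C0 e0 e1 e2 eventually_ge_at_top[of "2 * Suc k"]
  proof eventually_elim
    case (elim n)
    have n: "n > 0" using elim by simp
    have W: "(\<Sum>v<n. w n v) \<le> CW * real n" using elim(1) by simp
    have M: "real (m n) \<ge> cm * real n" using elim(2) by simp
    have m0: "m n > 0" using M cm(1) n by (cases "m n = 0") (auto simp: mult_le_0_iff)
    have sd: "s n ^ d = \<delta> / real n"
      unfolding s_def using \<delta> n d_pos by (intro powr_inverse_power) auto
    have rad: "(2 * rad d (s n) k) ^ d = A * \<delta> / real n"
      by (simp add: rad_def power_mult_distrib A_def sd)
    interpret geometric_instance d k n p T "s n" "w n"
    proof
      show "s n > 0" using \<delta> n by (simp add: s_def)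
      have "(2 * rad d (s n) k) ^ d * (\<Sum>v<n. w n v) \<le> A * \<delta> / real n * (CW * real n)"
        unfolding rad using W A \<delta> by (intro mult_left_mono) auto
      also have "\<dots> = 1 / 2" using n A CW(1) by (simp add: \<delta>_def)
      finally show "(2 * rad d (s n) k) ^ d * (\<Sum>v<n. w n v) \<le> 1 / 2" .
    qed (use d_pos p_pos T w_ge1 in auto)
    \<comment> \<open>Dividing by \<open>Suc k\<close> also covers \<open>k = 0\<close>. For
      \<open>n \<ge> 2 * Suc k\<close>, rounding down costs at most a factor of 2, which is the 2 in
      the definition of \<open>\<eta>\<close>.\<close>
    define h where "h = n div Suc k"
    have hk: "h * k \<le> n"
    proof -
      have "h * k \<le> h * Suc k" by simp
      also have "\<dots> \<le> n" unfolding h_def by (rule div_times_less_eq_dividend)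
      finally show ?thesis .
    qed
    have h: "real n / (2 * real (Suc k)) \<le> real h"
    proof -
      have "n < Suc h * Suc k"
        using dividend_less_div_times[of "Suc k" n] by (simp add: h_def)
      then have "real n < (real h + 1) * real (Suc k)"
        by (metis of_nat_Suc of_nat_less_iff of_nat_mult add.commute)
      moreover have "2 * real (Suc k) \<le> real n" using elim(7) by (metis of_nat_le_iff of_nat_mult of_nat_numeral)
      ultimately show ?thesis by (simp add: field_simps)
    qed
    have eta_le: "\<eta> \<le> (real h * s n ^ d) ^ k / 2"
    proof -
      have "\<delta> / (2 * real (Suc k)) = real n / (2 * real (Suc k)) * (\<delta> / real n)" using n by simp
      also have "\<dots> \<le> real h * (\<delta> / real n)" using h \<delta> by (intro mult_right_mono) auto
      finally have "(\<delta> / (2 * real (Suc k))) ^ k \<le> (real h * s n ^ d) ^ k"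
        unfolding sd using \<delta> by (intro power_mono) auto
      then show ?thesis by (simp add: \<eta>_def)
    qed
    \<comment> \<open>The weight bound enters here: a ball volume is at most a constant times
      \<open>w n v / n\<close>, hence of order \<open>n powr (- \<epsilon>)\<close>.\<close>
    define \<beta> where "\<beta> = B * real n powr (- \<epsilon>)"
    have \<beta>: "\<beta> > 0" using B n by (simp add: \<beta>_def)
    have bv_le: "ball_vol v \<le> \<beta>" if "v < n" for v
    proof -
      have "w n v \<le> C0 * real n powr (1 - \<epsilon>)" using elim(3) that by blast
      also have "\<dots> \<le> Cw * real n powr (1 - \<epsilon>)" by (intro mult_right_mono) (auto simp: Cw_def)
      finally have "ball_vol v \<le> A * \<delta> / real n * (Cw * real n powr (1 - \<epsilon>))"
        unfolding ball_vol_def rad using A \<delta> by (intro mult_left_mono) auto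
      also have "\<dots> = \<beta>" using n by (simp add: \<beta>_def B_def powr_diff powr_minus_divide)
      finally show ?thesis .
    qed
    have tc: "tail_const / K \<le> \<eta> / 4"
      using tail_const_pos \<eta> by (simp add: tail_const_def K_def)
    have main: "ennreal (1 - (exp (- \<eta>\<^sup>2 / (16 * \<beta>)) + exp (- real (m n) * q\<^sup>2 / 8) + exp (- real (m n) * q * r\<^sup>2 / 4)))
       \<le> prob_num_nice T d p k (w n) n (m n) (\<lambda>N. q * r / 4 * real (m n) \<le> real N \<and> real N \<le> 1 * real (m n))"
      by (rule prob_num_nice_ge[OF hk bv_le \<beta> \<eta> eta_le Kpos tc m0 q_def r_def])
    have "- \<eta>\<^sup>2 / (16 * \<beta>) = - (\<eta>\<^sup>2 / (16 * B)) * real n powr \<epsilon>"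
      using n B by (simp add: \<beta>_def powr_minus_divide)
    then have x0: "exp (- \<eta>\<^sup>2 / (16 * \<beta>)) \<le> 1 / real n" using elim(4) by simp
    have "cm * real n * (q\<^sup>2 / 8) \<le> real (m n) * (q\<^sup>2 / 8)" using M by (intro mult_right_mono) auto
    then have "exp (- real (m n) * q\<^sup>2 / 8) \<le> exp (- (cm * q\<^sup>2 / 8) * real n)" by (simp add: mult_ac)
    then have x1: "exp (- real (m n) * q\<^sup>2 / 8) \<le> 1 / real n" using elim(5) by linarith
    have "cm * real n * (q * r\<^sup>2 / 4) \<le> real (m n) * (q * r\<^sup>2 / 4)" using M q by (intro mult_right_mono) auto
    then have "exp (- real (m n) * q * r\<^sup>2 / 4) \<le> exp (- (cm * q * r\<^sup>2 / 4) * real n)" by (simp add: mult_ac)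
    then have x2: "exp (- real (m n) * q * r\<^sup>2 / 4) \<le> 1 / real n" using elim(6) by linarith
    have "ennreal (1 - 3 / real n) \<le> ennreal (1 - (exp (- \<eta>\<^sup>2 / (16 * \<beta>)) + exp (- real (m n) * q\<^sup>2 / 8) + exp (- real (m n) * q * r\<^sup>2 / 4)))"
      by (rule ennreal_leI) (use x0 x1 x2 in simp)
    also note main
    finally show ?case .
  qed
  \<comment> \<open>The constant 3 counts the failure terms, each eventually at most
    \<open>1 / n\<close>.\<close>
  then show ?thesis using q r by (intro exI[of _ "q * r / 4"] exI[of _ 1] exI[of _ 3]) auto
qed

end
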